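(* Let $n\ge1$, $c\in\mathbb C$, and let $\mathcal O_n(\mathbf z)=\sum_{\mathcal G^n}\mathcal L_\alpha(W(\mathcal G^n))$ be the genus two Virasoro differential operator, the sum being over all inequivalent order $n$ Virasoro graphs. Let $z\to\phi(z)$ be an analytic map (change of local coordinate). Then for each $i\in\{1,\dots,n\}$, $$\mathcal O_n(\mathbf z)=\mathcal O_n(z_1,\ldots,\phi(z_i),\ldots,z_n)+\frac c{12}\{\phi(z_i),z_i\}\,dz_i^2\;\mathcal O_{n-1}(z_1,\ldots,\widehat{z}_i,\ldots,z_n),$$ where $\{\phi(z),z\}=\frac{\phi'''(z)}{\phi'(z)}-\frac32\left(\frac{\phi''(z)}{\phi'(z)}\right)^2$ is the Schwarzian derivative and $\widehat z_i$ denotes omission of $z_i$.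
   Context: On a compact genus two Riemann surface with canonical homology basis $\alpha^i,\beta^i$ ($i=1,2$), $\omega(x,y)$ is the unique symmetric bidifferential, holomorphic for $x\ne y$, with $\oint_{\alpha^i}\omega(x,\cdot)=0$ and $\omega(x,y)=\frac{dx\,dy}{(x-y)^2}+\frac16s(x)+O(x-y)$ in local coordinates; this defines the projective connection $s(x)$ relative to the chosen local coordinate, which transforms under an analytic map $x\to\phi(x)$ as $s(x)=s(\phi(x))+\{\phi(x),x\}dx^2$. $\nu_i(x)=\oint_{\beta^i}\omega(x,\cdot)$ are the holomorphic 1-differentials, normalised by $\oint_{\alpha^i}\nu_j=2\pi i\delta_{ij}$, and $\Omega_{ij}=\frac1{2\pi i}\oint_{\beta^i}\nu_j$ is the period matrix in the Siegel upper half plane. An order $n$ Virasoro graph is a directed graph with vertices labelled $z_1,\dots,z_n$, each of degree 0, 1 or 2; degree 1 vertices have indegree 1 or outdegree 1, degree 2 vertices have indegree 1 and outdegree 1 (a loop gives degree 2). Components are $r$-cycles ($r\ge1$) or chains, a degree 0 vertex being a degenerate chain. Inequivalent graphs (up to label-preserving isomorphism) correspond to partial injective self-maps of $\{1,\dots,n\}$. An edge between $z_i,z_j$ has weight $\frac16s(z_i)$ if $i=j$ and $\omega(z_i,z_j)$ if $i\neq j$. A chain with first vertex $z_k$ and last vertex $z_\ell$ along its direction ($k=\ell$ if degenerate) has weight $A(z_k,z_\ell)=\sum_{1\le a\le b\le2}\nu_a(z_k)\nu_b(z_\ell)\alpha_{ab}$ with free commuting parameters $\alpha_{ab}=\alpha_{ba}$.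 If $\mathcal G^n$ has $K$ cycles, $W(\mathcal G^n)=(c/2)^K\prod(\text{edge weights})\prod(\text{chain weights})$, over all edges and all chains. $\mathcal L_\alpha$ is linear, sends $\alpha_{a_1b_1}\cdots\alpha_{a_Mb_M}$ to $\frac{\partial^M}{\partial\Omega_{a_1b_1}\cdots\partial\Omega_{a_Mb_M}}$ (independent coordinates $\Omega_{11},\Omega_{12},\Omega_{22}$), and leaves $\omega,\nu_a,s$ as coefficients to the left of the derivatives. By convention $\mathcal O_0=1$. $\mathcal O_n(z_1,\ldots,\phi(z_i),\ldots,z_n)$ denotes the same operator with the $i$-th point expressed in the coordinate $\phi(z_i)$ (in particular with $s(\phi(z_i))$ in place of $s(z_i)$). *)

theory Defs
  imports
    "HOL-Complex_Analysis.Complex_Analysis"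
    "HOL-Homology.Homology"
    "HOL-Library.Poly_Mapping"
    "HOL-Library.Landau_Symbols"
begin

section \<open>Riemann surfaces and differentials in local coordinates\<close>

text \<open>A chart \<open>(U, x)\<close> is a coordinate function \<open>x\<close> together with its domain \<open>U\<close>; values of \<open>x\<close>
  outside \<open>U\<close> carry no information.\<close>

type_synonym 'a chart = "'a set \<times> ('a \<Rightarrow> complex)"

definition is_chart :: "'a topology \<Rightarrow> 'a chart \<Rightarrow> bool" where
  "is_chart X = (\<lambda>(U, x). openin X U \<and> open (x ` U) \<and>
     homeomorphic_map (subtopology X U) (top_of_set (x ` U)) x)"

definition chart_inv :: "'a chart \<Rightarrow> complex \<Rightarrow> 'a" where
  "chart_inv = (\<lambda>(U, x). inv_into U x)"

text \<open>The coordinate of \<open>d\<close> as a function of the coordinate of \<open>c\<close>.\<close>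

definition transition :: "'a chart \<Rightarrow> 'a chart \<Rightarrow> complex \<Rightarrow> complex" where
  "transition c d = snd d \<circ> chart_inv c"

definition compatible :: "'a chart \<Rightarrow> 'a chart \<Rightarrow> bool" where
  "compatible c d \<longleftrightarrow>
     transition c d holomorphic_on snd c ` (fst c \<inter> fst d) \<and>
     transition d c holomorphic_on snd d ` (fst c \<inter> fst d)"

definition compact_riemann_surface :: "'a topology \<Rightarrow> 'a chart set \<Rightarrow> bool" where
  "compact_riemann_surface X \<A> \<longleftrightarrow>
     compact_space X \<and> connected_space X \<and> Hausdorff_space X \<and>
     (\<forall>c\<in>\<A>. is_chart X c) \<and> (\<Union>c\<in>\<A>. fst c) = topspace X \<and>
     (\<forall>c\<in>\<A>. \<forall>d\<in>\<A>. compatible c d)"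

text \<open>Local coordinates are the members of the maximal atlas generated by \<open>\<A>\<close>.\<close>

definition local_coord :: "'a topology \<Rightarrow> 'a chart set \<Rightarrow> 'a chart \<Rightarrow> bool" where
  "local_coord X \<A> c \<longleftrightarrow> is_chart X c \<and> (\<forall>d\<in>\<A>. compatible c d)"

text \<open>Joint holomorphy in several variables: real differentiability with complex linear
  derivative.\<close>

definition holomorphic_several :: "(complex ^ 'n \<Rightarrow> complex) \<Rightarrow> (complex ^ 'n) set \<Rightarrow> bool" where
  "holomorphic_several F W \<longleftrightarrow>
     (\<forall>v\<in>W. \<exists>D. (F has_derivative D) (at v) \<and> (\<forall>k u. D (k *s u) = k * D u))"

text \<open>A 1-differential is given by its coefficients: it is \<open>\<eta> c p\<close> times \<open>dx\<close> at the point \<open>p\<close>, for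
  \<open>c = (U, x)\<close> any local coordinate around \<open>p\<close>.\<close>

definition holomorphic_differential ::
  "'a topology \<Rightarrow> 'a chart set \<Rightarrow> ('a chart \<Rightarrow> 'a \<Rightarrow> complex) \<Rightarrow> bool" where
  "holomorphic_differential X \<A> \<eta> \<longleftrightarrow>
     (\<forall>c. local_coord X \<A> c \<longrightarrow> (\<lambda>u. \<eta> c (chart_inv c u)) holomorphic_on snd c ` fst c) \<and>
     (\<forall>c d p. local_coord X \<A> c \<and> local_coord X \<A> d \<and> p \<in> fst c \<inter> fst d \<longrightarrow>
        \<eta> c p = \<eta> d p * deriv (transition c d) (snd c p))"

section \<open>Loops, periods and canonical homology bases\<close>

definition piecewise_C1_loop :: "'a topology \<Rightarrow> 'a chart set \<Rightarrow> (real \<Rightarrow> 'a) \<Rightarrow> bool" where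
  "piecewise_C1_loop X \<A> \<gamma> \<longleftrightarrow> pathin X \<gamma> \<and> \<gamma> 0 = \<gamma> 1 \<and>
     (\<forall>c l r. local_coord X \<A> c \<and> 0 \<le> l \<and> l < r \<and> r \<le> 1 \<and> \<gamma> ` {l..r} \<subseteq> fst c \<longrightarrow>
        (snd c \<circ> \<gamma>) piecewise_C1_differentiable_on {l..r})"

definition has_form_integral ::
  "'a topology \<Rightarrow> 'a chart set \<Rightarrow> ('a chart \<Rightarrow> 'a \<Rightarrow> complex) \<Rightarrow> (real \<Rightarrow> 'a) \<Rightarrow> complex \<Rightarrow> bool" where
  "has_form_integral X \<A> \<eta> \<gamma> I \<longleftrightarrow>
     (\<exists>f N. finite N \<and> (f has_integral I) {0..1} \<and>
        (\<forall>t\<in>{0<..<1} - N. \<forall>c. local_coord X \<A> c \<and> \<gamma> t \<in> fst c \<longrightarrow>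
           (\<exists>v. ((snd c \<circ> \<gamma>) has_vector_derivative v) (at t) \<and> f t = \<eta> c (\<gamma> t) * v)))"

definition form_integral ::
  "'a topology \<Rightarrow> 'a chart set \<Rightarrow> ('a chart \<Rightarrow> 'a \<Rightarrow> complex) \<Rightarrow> (real \<Rightarrow> 'a) \<Rightarrow> complex" where
  "form_integral X \<A> \<eta> \<gamma> = (THE I. has_form_integral X \<A> \<eta> \<gamma> I)"

text \<open>The singular 1-chain of a loop; the 1-simplex is parametrised by its barycentric
  coordinate with index 1.\<close>

definition loop_chain :: "(real \<Rightarrow> 'a) \<Rightarrow> 'a chain" where
  "loop_chain \<gamma> = frag_of (restrict (\<lambda>f. \<gamma> (f 1)) (standard_simplex 1))"

definition crossings :: "(real \<Rightarrow> 'a) \<Rightarrow> (real \<Rightarrow> 'a) \<Rightarrow> (real \<times> real) set" where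
  "crossings \<gamma> \<delta> = {(s, t). s \<in> {0..<1} \<and> t \<in> {0..<1} \<and> \<gamma> s = \<delta> t}"

text \<open>Intersection numbers use the complex orientation: a transversal crossing counts \<open>+1\<close> if the
  tangent vectors \<open>(\<gamma>', \<delta>')\<close> form a positively oriented basis.  For homology classes the number
  is computed on transversal representatives.\<close>

definition transversal_intersection ::
  "'a topology \<Rightarrow> 'a chart set \<Rightarrow> (real \<Rightarrow> 'a) \<Rightarrow> (real \<Rightarrow> 'a) \<Rightarrow> int \<Rightarrow> bool" where
  "transversal_intersection X \<A> \<gamma> \<delta> k \<longleftrightarrow> finite (crossings \<gamma> \<delta>) \<and>
     (\<exists>e. k = (\<Sum>q\<in>crossings \<gamma> \<delta>. e q) \<and>
        (\<forall>(s, t)\<in>crossings \<gamma> \<delta>. 0 < s \<and> 0 < t \<and>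
           (\<forall>c. local_coord X \<A> c \<and> \<gamma> s \<in> fst c \<longrightarrow>
              (\<exists>v w. ((snd c \<circ> \<gamma>) has_vector_derivative v) (at s) \<and>
                     ((snd c \<circ> \<delta>) has_vector_derivative w) (at t) \<and>
                     Im (cnj v * w) \<noteq> 0 \<and> real_of_int (e (s, t)) = sgn (Im (cnj v * w))))))"

definition has_intersection_number ::
  "'a topology \<Rightarrow> 'a chart set \<Rightarrow> (real \<Rightarrow> 'a) \<Rightarrow> (real \<Rightarrow> 'a) \<Rightarrow> int \<Rightarrow> bool" where
  "has_intersection_number X \<A> \<gamma> \<delta> k \<longleftrightarrow>
     (\<exists>\<gamma>' \<delta>'. piecewise_C1_loop X \<A> \<gamma>' \<and> piecewise_C1_loop X \<A> \<delta>' \<and>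
        homologous_rel 1 X {} (loop_chain \<gamma>) (loop_chain \<gamma>') \<and>
        homologous_rel 1 X {} (loop_chain \<delta>) (loop_chain \<delta>') \<and>
        transversal_intersection X \<A> \<gamma>' \<delta>' k)"

definition has_genus :: "'a topology \<Rightarrow> nat \<Rightarrow> bool" where
  "has_genus X g \<longleftrightarrow> homology_group 1 X \<cong> free_Abelian_group {..<2 * g}"

text \<open>Canonical homology basis \<open>a i, b i\<close> (\<open>i = 1, 2\<close>): a basis of the first integral homology with
  the standard symplectic intersection numbers.\<close>

definition canonical_homology_basis ::
  "'a topology \<Rightarrow> 'a chart set \<Rightarrow> (nat \<Rightarrow> real \<Rightarrow> 'a) \<Rightarrow> (nat \<Rightarrow> real \<Rightarrow> 'a) \<Rightarrow> bool" where
  "canonical_homology_basis X \<A> a b \<longleftrightarrow>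
     (\<forall>i\<in>{1, 2}. piecewise_C1_loop X \<A> (a i) \<and> piecewise_C1_loop X \<A> (b i)) \<and>
     (\<forall>\<sigma>. singular_relcycle 1 X {} \<sigma> \<longrightarrow>
        (\<exists>k l. homologous_rel 1 X {} \<sigma>
           (\<Sum>i\<in>{1, 2}. frag_cmul (k i) (loop_chain (a i)) + frag_cmul (l i) (loop_chain (b i))))) \<and>
     (\<forall>k l. homologous_rel 1 X {} 0
           (\<Sum>i\<in>{1, 2}. frag_cmul (k i) (loop_chain (a i)) + frag_cmul (l i) (loop_chain (b i))) \<longrightarrow>
        (\<forall>i\<in>{1, 2}. k i = 0 \<and> l i = 0)) \<and>
     (\<forall>i\<in>{1, 2}. \<forall>j\<in>{1, 2}.
        has_intersection_number X \<A> (a i) (b j) (if i = j then 1 else 0) \<and>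
        (i \<noteq> j \<longrightarrow> has_intersection_number X \<A> (a i) (a j) 0 \<and>
                     has_intersection_number X \<A> (b i) (b j) 0))"

section \<open>The bidifferential, its projective connection, and the period matrix\<close>

text \<open>A bidifferential \<open>\<omega>\<close> is given by coefficients: it is \<open>\<omega> c d p q\<close> times \<open>dx dy\<close> at \<open>(p, q)\<close>, for local
  coordinates \<open>c = (U, x)\<close> around \<open>p\<close> and \<open>d = (V, y)\<close> around \<open>q\<close>.\<close>

type_synonym 'a bidiff = "'a chart \<Rightarrow> 'a chart \<Rightarrow> 'a \<Rightarrow> 'a \<Rightarrow> complex"

text \<open>\<open>diagonal_term \<omega> c p \<sigma>\<close>: in the coordinate \<open>c = (U, x)\<close> one has
  \<open>\<omega> c c p q = 1 / (x p - x q)\<^sup>2 + \<sigma> / 6 + O(x p - x q)\<close> as \<open>q\<close> tends to \<open>p\<close>.\<close>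

definition diagonal_term :: "'a bidiff \<Rightarrow> 'a chart \<Rightarrow> 'a \<Rightarrow> complex \<Rightarrow> bool" where
  "diagonal_term \<omega> c p \<sigma> \<longleftrightarrow>
     (\<lambda>u. \<omega> c c p (chart_inv c u) - (1 / (snd c p - u)\<^sup>2 + \<sigma> / 6)) \<in> O[at (snd c p)](\<lambda>u. snd c p - u)"

definition proj_conn :: "'a bidiff \<Rightarrow> 'a chart \<Rightarrow> 'a \<Rightarrow> complex" where
  "proj_conn \<omega> c p = (THE \<sigma>. diagonal_term \<omega> c p \<sigma>)"

definition normalised_bidifferential ::
  "'a topology \<Rightarrow> 'a chart set \<Rightarrow> (nat \<Rightarrow> real \<Rightarrow> 'a) \<Rightarrow> 'a bidiff \<Rightarrow> bool" where
  "normalised_bidifferential X \<A> a \<omega> \<longleftrightarrow>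
     (\<forall>c c' d d' p q. local_coord X \<A> c \<and> local_coord X \<A> c' \<and> local_coord X \<A> d \<and> local_coord X \<A> d' \<and>
        p \<in> fst c \<inter> fst c' \<and> q \<in> fst d \<inter> fst d' \<and> p \<noteq> q \<longrightarrow>
        \<omega> c d p q = \<omega> c' d' p q * deriv (transition c c') (snd c p) * deriv (transition d d') (snd d q)) \<and>
     (\<forall>c d p q. local_coord X \<A> c \<and> local_coord X \<A> d \<and> p \<in> fst c \<and> q \<in> fst d \<and> p \<noteq> q \<longrightarrow>
        \<omega> c d p q = \<omega> d c q p) \<and>
     (\<forall>c d. local_coord X \<A> c \<and> local_coord X \<A> d \<longrightarrow>
        holomorphic_several (\<lambda>v :: complex ^ 2. \<omega> c d (chart_inv c (v $ 1)) (chart_inv d (v $ 2)))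
          {v. v $ 1 \<in> snd c ` fst c \<and> v $ 2 \<in> snd d ` fst d \<and>
              chart_inv c (v $ 1) \<noteq> chart_inv d (v $ 2)}) \<and>
     (\<forall>c p. local_coord X \<A> c \<and> p \<in> fst c \<longrightarrow> (\<exists>\<sigma>. diagonal_term \<omega> c p \<sigma>)) \<and>
     (\<forall>i\<in>{1, 2}. \<forall>c p. local_coord X \<A> c \<and> p \<in> fst c - a i ` {0..1} \<longrightarrow>
        has_form_integral X \<A> (\<lambda>d q. \<omega> c d p q) (a i) 0)"

text \<open>The differentials obtained by integrating \<open>\<omega>(x, \<cdot>)\<close> over the loops \<open>b i\<close>.  The loop integral
  requires \<open>x\<close> off the loop; holomorphy fixes the values of \<open>\<nu> i\<close> on the loop.\<close>

definition b_period_differentials ::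
  "'a topology \<Rightarrow> 'a chart set \<Rightarrow> (nat \<Rightarrow> real \<Rightarrow> 'a) \<Rightarrow> 'a bidiff \<Rightarrow>
     (nat \<Rightarrow> 'a chart \<Rightarrow> 'a \<Rightarrow> complex) \<Rightarrow> bool" where
  "b_period_differentials X \<A> b \<omega> \<nu> \<longleftrightarrow>
     (\<forall>i\<in>{1, 2}. holomorphic_differential X \<A> (\<nu> i) \<and>
        (\<forall>c p. local_coord X \<A> c \<and> p \<in> fst c - b i ` {0..1} \<longrightarrow>
           has_form_integral X \<A> (\<lambda>d q. \<omega> c d p q) (b i) (\<nu> i c p)))"

definition period_matrix ::
  "'a topology \<Rightarrow> 'a chart set \<Rightarrow> (nat \<Rightarrow> real \<Rightarrow> 'a) \<Rightarrow> (nat \<Rightarrow> 'a chart \<Rightarrow> 'a \<Rightarrow> complex) \<Rightarrow>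
     nat \<Rightarrow> nat \<Rightarrow> complex" where
  "period_matrix X \<A> b \<nu> i j = form_integral X \<A> (\<nu> j) (b i) / (2 * of_real pi * \<i>)"

definition period_point ::
  "'a topology \<Rightarrow> 'a chart set \<Rightarrow> (nat \<Rightarrow> real \<Rightarrow> 'a) \<Rightarrow> (nat \<Rightarrow> 'a chart \<Rightarrow> 'a \<Rightarrow> complex) \<Rightarrow>
     complex ^ 3" where
  "period_point X \<A> b \<nu> =
     vector [period_matrix X \<A> b \<nu> 1 1, period_matrix X \<A> b \<nu> 1 2, period_matrix X \<A> b \<nu> 2 2]"

definition genus_two_surface ::
  "'a topology \<Rightarrow> 'a chart set \<Rightarrow> (nat \<Rightarrow> real \<Rightarrow> 'a) \<Rightarrow> (nat \<Rightarrow> real \<Rightarrow> 'a) \<Rightarrow> 'a bidiff \<Rightarrow>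
     (nat \<Rightarrow> 'a chart \<Rightarrow> 'a \<Rightarrow> complex) \<Rightarrow> bool" where
  "genus_two_surface X \<A> a b \<omega> \<nu> \<longleftrightarrow>
     compact_riemann_surface X \<A> \<and> has_genus X 2 \<and> canonical_homology_basis X \<A> a b \<and>
     normalised_bidifferential X \<A> a \<omega> \<and> b_period_differentials X \<A> b \<omega> \<nu>"

section \<open>Virasoro graphs\<close>

text \<open>A directed graph on labelled vertices \<open>V\<close> is given by its edge set, so label-preserving
  isomorphic graphs are equal.  The degree conditions exclude parallel edges, so sets suffice.\<close>

definition indeg :: "(nat \<times> nat) set \<Rightarrow> nat \<Rightarrow> nat" where
  "indeg E v = card {u. (u, v) \<in> E}"

definition outdeg :: "(nat \<times> nat) set \<Rightarrow> nat \<Rightarrow> nat" where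
  "outdeg E v = card {w. (v, w) \<in> E}"

definition degree_in :: "(nat \<times> nat) set \<Rightarrow> nat \<Rightarrow> nat" where
  "degree_in E v = indeg E v + outdeg E v"

definition virasoro_graphs :: "nat \<Rightarrow> (nat \<times> nat) set set" where
  "virasoro_graphs n = {E. E \<subseteq> {1..n} \<times> {1..n} \<and>
     (\<forall>v\<in>{1..n}. degree_in E v \<in> {0, 1, 2} \<and>
        (degree_in E v = 2 \<longrightarrow> indeg E v = 1 \<and> outdeg E v = 1))}"

definition components :: "nat \<Rightarrow> (nat \<times> nat) set \<Rightarrow> nat set set" where
  "components n E = (\<lambda>v. (E \<union> E\<inverse>)\<^sup>* `` {v}) ` {1..n}"

definition cycles :: "nat \<Rightarrow> (nat \<times> nat) set \<Rightarrow> nat set set" where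
  "cycles n E = {C \<in> components n E. \<forall>v\<in>C. degree_in E v = 2}"

text \<open>A chain is recorded by its first and last vertex, which determine it.\<close>

definition chains :: "nat \<Rightarrow> (nat \<times> nat) set \<Rightarrow> (nat \<times> nat) set" where
  "chains n E = {(k, l). k \<in> {1..n} \<and> l \<in> {1..n} \<and> indeg E k = 0 \<and> outdeg E l = 0 \<and> (k, l) \<in> E\<^sup>*}"

section \<open>Weights and the genus two Virasoro differential operator\<close>

text \<open>Polynomials in \<open>\<alpha>\<^sub>1\<^sub>1, \<alpha>\<^sub>1\<^sub>2 = \<alpha>\<^sub>2\<^sub>1, \<alpha>\<^sub>2\<^sub>2\<close> with complex coefficients are finitely supported maps on
  exponents; the three variables are numbered 1, 2, 3 in this order, as are the coordinates of
  \<open>period_point\<close>.\<close>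

type_synonym alpha_poly = "(3 \<Rightarrow>\<^sub>0 nat) \<Rightarrow>\<^sub>0 complex"

definition pair_index :: "nat \<Rightarrow> nat \<Rightarrow> 3" where
  "pair_index i j = (if i = 1 \<and> j = 1 then 1 else if i = 2 \<and> j = 2 then 3 else 2)"

definition alpha :: "nat \<Rightarrow> nat \<Rightarrow> alpha_poly" where
  "alpha i j = Poly_Mapping.single (Poly_Mapping.single (pair_index i j) 1) 1"

definition alpha_const :: "complex \<Rightarrow> alpha_poly" where
  "alpha_const k = Poly_Mapping.single 0 k"

text \<open>An insertion is a local coordinate together with a point of its domain.  All weights below
  are coefficients of differentials with respect to \<open>dx\<close> for the coordinates \<open>x\<close> of the insertions.\<close>

type_synonym 'a insertion = "'a chart \<times> 'a"

definition edge_weight :: "'a bidiff \<Rightarrow> (nat \<Rightarrow> 'a insertion) \<Rightarrow> nat \<times> nat \<Rightarrow> complex" where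
  "edge_weight \<omega> z = (\<lambda>(i, j).
     if i = j then proj_conn \<omega> (fst (z i)) (snd (z i)) / 6
     else \<omega> (fst (z i)) (fst (z j)) (snd (z i)) (snd (z j)))"

definition chain_weight ::
  "(nat \<Rightarrow> 'a chart \<Rightarrow> 'a \<Rightarrow> complex) \<Rightarrow> (nat \<Rightarrow> 'a insertion) \<Rightarrow> nat \<times> nat \<Rightarrow> alpha_poly" where
  "chain_weight \<nu> z = (\<lambda>(k, l). \<Sum>(i, j)\<in>{(i, j). 1 \<le> i \<and> i \<le> j \<and> j \<le> 2}.
     alpha_const (\<nu> i (fst (z k)) (snd (z k)) * \<nu> j (fst (z l)) (snd (z l))) * alpha i j)"

definition graph_weight ::
  "complex \<Rightarrow> 'a bidiff \<Rightarrow> (nat \<Rightarrow> 'a chart \<Rightarrow> 'a \<Rightarrow> complex) \<Rightarrow> nat \<Rightarrow> (nat \<Rightarrow> 'a insertion) \<Rightarrow>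
     (nat \<times> nat) set \<Rightarrow> alpha_poly" where
  "graph_weight c \<omega> \<nu> n z E =
     alpha_const ((c / 2) ^ card (cycles n E) * (\<Prod>e\<in>E. edge_weight \<omega> z e)) *
     (\<Prod>h\<in>chains n E. chain_weight \<nu> z h)"

definition partial_deriv :: "3 \<Rightarrow> (complex ^ 3 \<Rightarrow> complex) \<Rightarrow> complex ^ 3 \<Rightarrow> complex" where
  "partial_deriv j F v = deriv (\<lambda>t. F (\<chi> k. if k = j then t else v $ k)) (v $ j)"

definition monomial_deriv ::
  "(3 \<Rightarrow>\<^sub>0 nat) \<Rightarrow> (complex ^ 3 \<Rightarrow> complex) \<Rightarrow> complex ^ 3 \<Rightarrow> complex" where
  "monomial_deriv m F =
     (partial_deriv 1 ^^ Poly_Mapping.lookup m 1)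
       ((partial_deriv 2 ^^ Poly_Mapping.lookup m 2)
         ((partial_deriv 3 ^^ Poly_Mapping.lookup m 3) F))"

text \<open>The linear map from polynomials in the \<open>\<alpha>\<^sub>a\<^sub>b\<close> to differential operators; the coefficients belong
  to one fixed surface, so the operator is evaluated at the period point \<open>\<tau>\<close> of that surface.\<close>

definition alpha_to_operator :: "complex ^ 3 \<Rightarrow> alpha_poly \<Rightarrow> (complex ^ 3 \<Rightarrow> complex) \<Rightarrow> complex" where
  "alpha_to_operator \<tau> P F =
     (\<Sum>m\<in>Poly_Mapping.keys P. Poly_Mapping.lookup P m * monomial_deriv m F \<tau>)"

definition virasoro_operator ::
  "'a topology \<Rightarrow> 'a chart set \<Rightarrow> (nat \<Rightarrow> real \<Rightarrow> 'a) \<Rightarrow> 'a bidiff \<Rightarrow>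
     (nat \<Rightarrow> 'a chart \<Rightarrow> 'a \<Rightarrow> complex) \<Rightarrow> complex \<Rightarrow> nat \<Rightarrow> (nat \<Rightarrow> 'a insertion) \<Rightarrow>
     (complex ^ 3 \<Rightarrow> complex) \<Rightarrow> complex" where
  "virasoro_operator X \<A> b \<omega> \<nu> c n z F =
     (\<Sum>E\<in>virasoro_graphs n.
        alpha_to_operator (period_point X \<A> b \<nu>) (graph_weight c \<omega> \<nu> n z E) F)"

section \<open>Change of coordinate\<close>

definition schwarzian :: "(complex \<Rightarrow> complex) \<Rightarrow> complex \<Rightarrow> complex" where
  "schwarzian \<phi> u = (deriv ^^ 3) \<phi> u / deriv \<phi> u - 3 / 2 * ((deriv ^^ 2) \<phi> u / deriv \<phi> u)\<^sup>2"

definition change_coord :: "(complex \<Rightarrow> complex) \<Rightarrow> 'a insertion \<Rightarrow> 'a insertion" where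
  "change_coord \<phi> = (\<lambda>((U, x), p). ((U, \<phi> \<circ> x), p))"

definition omit :: "nat \<Rightarrow> (nat \<Rightarrow> 'b) \<Rightarrow> nat \<Rightarrow> 'b" where
  "omit i z j = (if j < i then z j else z (j + 1))"

lemma virasoro_graphs_0: "virasoro_graphs 0 = {{}}"
  by (auto simp: virasoro_graphs_def)

text \<open>The convention that the operator of order 0 is the identity holds by definition.\<close>

lemma virasoro_operator_0: "virasoro_operator X \<A> b \<omega> \<nu> c 0 z F = F (period_point X \<A> b \<nu>)"
  by (simp add: virasoro_operator_def virasoro_graphs_0 graph_weight_def cycles_def components_def
      chains_def alpha_const_def alpha_to_operator_def monomial_deriv_def)

end

(* Under a change of coordinate at z_i, omega and nu pick up a factor phi', while s picks up phi'^2 and the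
   Schwarzian (from the constant term of phi'(w) phi'(u) / (phi w - phi u)^2 at u = w).  In a graph
   without loop at i, the vertex i carries exactly two edge or chain ends, so its weight scales by
   phi'^2.  A loop at i is a component of its own, which turns the additive term of s / 6 into
   (c / 2) (S / 6) times the weight of the graph with i removed; these graphs are exactly the graphs of
   order n - 1. *)

theory Submission
  imports Defs
begin

section \<open>Virasoro graphs as partial injections\<close>

text \<open>All weights are coefficients with respect to the coordinate differentials, so the
  Jacobian that the notation with differentials hides in the operator at \<open>\<phi>(z_i)\<close>
  appears as the explicit factor \<open>(deriv \<phi> (x p))\<^sup>2\<close>. Exactly two ends meet
  at a vertex because each of its two sides, incoming and outgoing, carries an edge or, failing
  that, a chain end; an isolated vertex is both first and last in its degenerate chain and counts
  twice. The point to prove is that a vertex without predecessor really starts a chain, that is,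
  that its path stops, and this rests on finiteness together with injectivity. Only loops can
  produce the Schwarzian: the points are distinct, so every other edge evaluates \<omega> off the
  diagonal, where it is multiplied by Jacobians alone. The expansion that defines s holds the first
  point fixed, so the Jacobian is \<open>\<phi>' w * \<phi>' u\<close> with u moving. Against the
  double pole its variation matters up to second order, hence third derivatives of \<phi>
  enter.\<close>

lemma finite_predecessors: "finite E \<Longrightarrow> finite {u. (u, v) \<in> E}"
  by (rule finite_subset[of _ "fst ` E"]) force+

lemma indeg_le_1_iff: "finite E \<Longrightarrow> (\<forall>v. indeg E v \<le> 1) \<longleftrightarrow> single_valued (E\<inverse>)"
proof -
  assume "finite E"
  then have "finite {u. (u, v) \<in> E}" for v
    by (rule finite_predecessors)
  then show ?thesis
    by (auto simp: indeg_def single_valued_def card_le_Suc0_iff_eq)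
qed

lemma outdeg_eq_indeg_converse: "outdeg E v = indeg (E\<inverse>) v"
  by (simp add: outdeg_def indeg_def)

lemma outdeg_le_1_iff: "finite E \<Longrightarrow> (\<forall>v. outdeg E v \<le> 1) \<longleftrightarrow> single_valued E"
  using indeg_le_1_iff[of "E\<inverse>"] by (simp add: outdeg_eq_indeg_converse)

text \<open>The degree conditions say precisely that indegree and outdegree are at most 1. Vertices
  outside \<open>{1..n}\<close> have degree 0, so the bounds may be quantified over all labels,
  where they become single-valuedness of the edge relation and of its converse.\<close>

lemma virasoro_graphs_iff:
  "E \<in> virasoro_graphs n \<longleftrightarrow>
     E \<subseteq> {1..n} \<times> {1..n} \<and> single_valued E \<and> single_valued (E\<inverse>)" (is "?L \<longleftrightarrow> ?R")
proof (cases "E \<subseteq> {1..n} \<times> {1..n}")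
  case True
  then have fin: "finite E"
    by (rule finite_subset) simp
  have out: "indeg E v = 0 \<and> outdeg E v = 0" if "v \<notin> {1..n}" for v
  proof -
    have "{u. (u, v) \<in> E} = {}" "{u. (v, u) \<in> E} = {}"
      using that True by auto
    then show ?thesis
      by (simp add: indeg_def outdeg_def)
  qed
  have "?L \<longleftrightarrow> (\<forall>v\<in>{1..n}. indeg E v \<le> 1 \<and> outdeg E v \<le> 1)"
    unfolding virasoro_graphs_def mem_Collect_eq degree_in_def
    using True by (intro iffI conjI ballI; force)
  also have "\<dots> \<longleftrightarrow> (\<forall>v. indeg E v \<le> 1) \<and> (\<forall>v. outdeg E v \<le> 1)"
    using out by (metis zero_le)
  finally show ?thesis
    using True indeg_le_1_iff[OF fin] outdeg_le_1_iff[OF fin] by auto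
qed (auto simp: virasoro_graphs_def)

lemma finite_virasoro_graph: "E \<in> virasoro_graphs n \<Longrightarrow> finite E"
  unfolding virasoro_graphs_iff by (elim conjE, rule finite_subset) auto

lemma finite_virasoro_graphs: "finite (virasoro_graphs n)"
  by (rule finite_subset[of _ "Pow ({1..n} \<times> {1..n})"]) (auto simp: virasoro_graphs_def)

section \<open>Chains and the number of chain ends at a vertex\<close>

lemma indeg_eq_0_iff: "finite E \<Longrightarrow> indeg E v = 0 \<longleftrightarrow> v \<notin> Range E"
  using finite_predecessors[of E v] by (auto simp: indeg_def)

lemma outdeg_eq_0_iff: "finite E \<Longrightarrow> outdeg E v = 0 \<longleftrightarrow> v \<notin> Domain E"
  using indeg_eq_0_iff[of "E\<inverse>"] by (simp add: outdeg_eq_indeg_converse)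

lemma chains_eq:
  assumes "finite E"
  shows "chains n E =
    {(k, l). k \<in> {1..n} \<and> l \<in> {1..n} \<and> k \<notin> Range E \<and> l \<notin> Domain E \<and> (k, l) \<in> E\<^sup>*}"
  by (simp add: chains_def indeg_eq_0_iff[OF assms] outdeg_eq_0_iff[OF assms])

lemma finite_chains: "finite (chains n E)"
  by (rule finite_subset[of _ "{1..n} \<times> {1..n}"]) (auto simp: chains_def)

text \<open>If every vertex reachable from \<open>k\<close> had a successor, the successor map would be an injection of
  this finite set into itself missing \<open>k\<close>.\<close>

lemma ex1_chain_end:
  assumes fin: "finite E" and "single_valued E" "single_valued (E\<inverse>)" and k: "k \<notin> Range E"
  shows "\<exists>!l. l \<notin> Domain E \<and> (k, l) \<in> E\<^sup>*"
proof (rule ex_ex1I)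
  show "\<exists>l. l \<notin> Domain E \<and> (k, l) \<in> E\<^sup>*"
  proof (rule ccontr)
    assume "\<not> ?thesis"
    then have "\<exists>w. (v, w) \<in> E" if "v \<in> E\<^sup>* `` {k}" for v
      using that by auto
    then obtain f where f: "\<And>v. v \<in> E\<^sup>* `` {k} \<Longrightarrow> (v, f v) \<in> E"
      by metis
    have "E\<^sup>* `` {k} \<subseteq> insert k (Range E)"
      by (auto elim: rtranclE)
    then have "finite (E\<^sup>* `` {k})"
      by (rule finite_subset) (simp add: fin finite_Range)
    moreover have "inj_on f (E\<^sup>* `` {k})"
      using f assms(3) unfolding inj_on_def single_valued_def by (metis converse_iff)
    moreover have "f ` (E\<^sup>* `` {k}) \<subseteq> E\<^sup>* `` {k}"
      using f by (fastforce intro: rtrancl_into_rtrancl)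
    ultimately have "f ` (E\<^sup>* `` {k}) = E\<^sup>* `` {k}"
      by (intro endo_inj_surj)
    moreover have "k \<in> E\<^sup>* `` {k}"
      by simp
    ultimately obtain v where "v \<in> E\<^sup>* `` {k}" "k = f v"
      by blast
    with f k show False
      by blast
  qed
next
  fix l l' assume *: "l \<notin> Domain E \<and> (k, l) \<in> E\<^sup>*" "l' \<notin> Domain E \<and> (k, l') \<in> E\<^sup>*"
  \<comment> \<open>Two vertices reached from \<open>k\<close> along a single-valued relation are
    comparable, and a vertex without successor reaches only itself.\<close>
  then have "(l, l') \<in> E\<^sup>* \<or> (l', l) \<in> E\<^sup>*"
    using single_valued_confluent[OF assms(2)] by blast
  with * show "l = l'"
    by (auto elim: converse_rtranclE)
qed

lemma rtrancl_into_vertices: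
  assumes "E \<subseteq> V \<times> V" "(k, l) \<in> E\<^sup>*"
  shows "k \<in> V \<longleftrightarrow> l \<in> V"
  using assms(2) by induction (use assms(1) in auto)

text \<open>Either an edge enters \<open>i\<close>, and then no chain can start there, or none does
  and \<open>ex1_chain_end\<close> supplies exactly one. The incoming side of \<open>i\<close> is
  thus occupied exactly once.\<close>

lemma card_chains_from:
  assumes E: "E \<in> virasoro_graphs n" and i: "i \<in> {1..n}"
  shows "card {h \<in> chains n E. fst h = i} = 1 - indeg E i"
proof -
  note E' = E[unfolded virasoro_graphs_iff]
  have fin: "finite E"
    using E by (rule finite_virasoro_graph)
  show ?thesis
  proof (cases "i \<in> Range E")
    case True
    then have "{h \<in> chains n E. fst h = i} = {}"
      by (auto simp: chains_eq[OF fin])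
    moreover have "indeg E i \<noteq> 0"
      using indeg_eq_0_iff[OF fin] True by simp
    ultimately show ?thesis
      by (metis card.empty One_nat_def diff_is_0_eq less_one not_le)
  next
    case False
    have "\<exists>!l. l \<notin> Domain E \<and> (i, l) \<in> E\<^sup>*"
      using ex1_chain_end[OF fin _ _ False] E' by blast
    then obtain l where l: "l \<notin> Domain E" "(i, l) \<in> E\<^sup>*"
      "\<And>l'. l' \<notin> Domain E \<Longrightarrow> (i, l') \<in> E\<^sup>* \<Longrightarrow> l' = l"
      by (elim ex1E) blast
    have "l \<in> {1..n}"
      using rtrancl_into_vertices[OF _ l(2)] E' i by blast
    then have "{h \<in> chains n E. fst h = i} = {(i, l)}"
      unfolding chains_eq[OF fin] using l(1,2) False i by (auto dest: l(3))
    moreover have "indeg E i = 0"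
      using indeg_eq_0_iff[OF fin] False by simp
    ultimately show ?thesis
      by simp
  qed
qed

lemma converse_virasoro_graphs: "E\<inverse> \<in> virasoro_graphs n \<longleftrightarrow> E \<in> virasoro_graphs n"
  unfolding virasoro_graphs_iff by auto

lemma chains_converse: "chains n (E\<inverse>) = (chains n E)\<inverse>"
  by (auto simp: chains_def indeg_def outdeg_def rtrancl_converse)

text \<open>Reversing all edges turns last vertices of chains into first ones and outdegree into
  indegree.\<close>

lemma card_chains_to:
  assumes "E \<in> virasoro_graphs n" "i \<in> {1..n}"
  shows "card {h \<in> chains n E. snd h = i} = 1 - outdeg E i"
proof -
  have "{h \<in> chains n (E\<inverse>). fst h = i} = prod.swap ` {h \<in> chains n E. snd h = i}"
    by (force simp: chains_converse)
  then have "card {h \<in> chains n E. snd h = i} = card {h \<in> chains n (E\<inverse>). fst h = i}"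
    by (simp add: card_image)
  also have "\<dots> = 1 - outdeg E i"
    using card_chains_from[of "E\<inverse>" n i] assms
    by (simp add: converse_virasoro_graphs outdeg_eq_indeg_converse)
  finally show ?thesis .
qed

lemma card_edges_from: "card {e \<in> E. fst e = i} = outdeg E i"
proof -
  have "{e \<in> E. fst e = i} = Pair i ` {w. (i, w) \<in> E}"
    by force
  then show ?thesis
    by (simp add: outdeg_def card_image inj_on_def)
qed

lemma card_edges_to: "card {e \<in> E. snd e = i} = indeg E i"
proof -
  have "{e \<in> E. snd e = i} = (\<lambda>u. (u, i)) ` {u. (u, i) \<in> E}"
    by force
  then show ?thesis
    by (simp add: indeg_def card_image inj_on_def)
qed

section \<open>Removing an isolated loop\<close>

text \<open>The increasing injection that misses the value \<open>i\<close>; precomposition with it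
  is \<open>omit\<close>.\<close>

definition skip :: "nat \<Rightarrow> nat \<Rightarrow> nat" where
  "skip i j = (if j < i then j else j + 1)"

lemma inj_skip: "inj (skip i)"
  by (auto simp: inj_on_def skip_def split: if_splits)

lemma skip_eq_iff [simp]: "skip i j = skip i k \<longleftrightarrow> j = k"
  using inj_skip by (auto simp: inj_on_def)

lemma skip_neq [simp]: "skip i j \<noteq> i" "i \<noteq> skip i j"
  by (auto simp: skip_def)

lemma skip_image: "i \<in> {1..n} \<Longrightarrow> skip i ` {1..n - 1} = {1..n} - {i}"
proof (intro equalityI subsetI)
  fix j assume "i \<in> {1..n}" "j \<in> {1..n} - {i}"
  then have "j = skip i (if j < i then j else j - 1)" "(if j < i then j else j - 1) \<in> {1..n - 1}"
    by (auto simp: skip_def)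
  then show "j \<in> skip i ` {1..n - 1}"
    by blast
qed (auto simp: skip_def)

lemma omit_eq_skip: "omit i z j = z (skip i j)"
  by (simp add: omit_def skip_def)

text \<open>Inverse to deleting a vertex \<open>i\<close> whose only edge is a loop and closing the
  gap in the labels. This direction is total and injective, so it can reindex sums over
  graphs.\<close>

definition add_loop :: "nat \<Rightarrow> (nat \<times> nat) set \<Rightarrow> (nat \<times> nat) set" where
  "add_loop i E = insert (i, i) (map_prod (skip i) (skip i) ` E)"

lemma add_loop_iff [simp]:
  "(i, i) \<in> add_loop i E"
  "(skip i j, skip i k) \<in> add_loop i E \<longleftrightarrow> (j, k) \<in> E"
  "(skip i j, i) \<notin> add_loop i E" "(i, skip i k) \<notin> add_loop i E"
  by (auto simp: add_loop_def)

lemma skip_cases: obtains "j = i" | k where "j = skip i k"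
proof (cases "j = i")
  case False
  then have "j = skip i (if j < i then j else j - 1)"
    by (auto simp: skip_def)
  with that show ?thesis
    by blast
qed (use that in blast)

lemma add_loop_converse: "(add_loop i E)\<inverse> = add_loop i (E\<inverse>)"
  by (force simp: add_loop_def)

lemma add_loop_Un: "add_loop i E \<union> add_loop i E' = add_loop i (E \<union> E')"
  by (auto simp: add_loop_def)

lemma inj_add_loop: "inj (add_loop i)"
proof (rule injI)
  fix E E' :: "(nat \<times> nat) set" assume "add_loop i E = add_loop i E'"
  then have "(j, k) \<in> E \<longleftrightarrow> (j, k) \<in> E'" for j k
    using add_loop_iff(2)[of i j k] by blast
  then show "E = E'"
    by auto
qed

lemma single_valued_add_loop: "single_valued (add_loop i E) \<longleftrightarrow> single_valued E"
proof
  assume sv: "single_valued E"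
  show "single_valued (add_loop i E)"
  proof (rule single_valuedI)
    fix a b c assume "(a, b) \<in> add_loop i E" "(a, c) \<in> add_loop i E"
    then show "b = c"
      by (cases a rule: skip_cases[of _ i]; cases b rule: skip_cases[of _ i];
          cases c rule: skip_cases[of _ i]) (use sv in \<open>auto simp: single_valued_def\<close>)
  qed
next
  assume sv: "single_valued (add_loop i E)"
  show "single_valued E"
    using sv add_loop_iff(2)[of i _ _ E] unfolding single_valued_def by (metis skip_eq_iff)
qed

text \<open>The loop uses up the single outgoing and the single incoming edge allowed at
  \<open>i\<close>. No other edge touches \<open>i\<close>, and the rest is an arbitrary partial
  injection of the remaining labels.\<close>

lemma virasoro_graphs_with_loop:
  assumes i: "i \<in> {1..n}"
  shows "{E \<in> virasoro_graphs n. (i, i) \<in> E} = add_loop i ` virasoro_graphs (n - 1)"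
proof -
  have sub: "add_loop i E \<subseteq> {1..n} \<times> {1..n} \<longleftrightarrow> E \<subseteq> {1..n - 1} \<times> {1..n - 1}" for E
  proof -
    have s: "skip i j \<in> {1..n} \<longleftrightarrow> j \<in> {1..n - 1}" for j
      using i by (auto simp: skip_def)
    have "add_loop i E \<subseteq> {1..n} \<times> {1..n} \<longleftrightarrow>
        (\<forall>(j, k)\<in>E. skip i j \<in> {1..n} \<and> skip i k \<in> {1..n})"
      using i by (auto simp: add_loop_def)
    then show ?thesis
      unfolding s by auto
  qed
  have *: "add_loop i E \<in> virasoro_graphs n \<longleftrightarrow> E \<in> virasoro_graphs (n - 1)" for E
    unfolding virasoro_graphs_iff sub add_loop_converse single_valued_add_loop ..
  have "E \<in> range (add_loop i)" if E: "E \<in> virasoro_graphs n" "(i, i) \<in> E" for E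
  proof -
    have "E = add_loop i {(j, k). (skip i j, skip i k) \<in> E}"
      unfolding set_eq_iff split_paired_All
    proof (intro allI)
      fix a b
      have "a = i \<longleftrightarrow> b = i" if "(a, b) \<in> E"
        using that E unfolding virasoro_graphs_iff single_valued_def by auto
      then show "(a, b) \<in> E \<longleftrightarrow> (a, b) \<in> add_loop i {(j, k). (skip i j, skip i k) \<in> E}"
        by (cases a rule: skip_cases[of _ i]; cases b rule: skip_cases[of _ i]) (auto simp: E(2))
    qed
    then show ?thesis
      by blast
  qed
  with * show ?thesis
    using add_loop_iff(1) by blast
qed

section \<open>Reachability, degrees, chains and cycles after adding an isolated loop\<close>

lemma rtrancl_add_loop:
  "(skip i j, m) \<in> (add_loop i E)\<^sup>* \<longleftrightarrow> (\<exists>k. m = skip i k \<and> (j, k) \<in> E\<^sup>*)"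
proof
  assume "(skip i j, m) \<in> (add_loop i E)\<^sup>*"
  then show "\<exists>k. m = skip i k \<and> (j, k) \<in> E\<^sup>*"
  proof induction
    case (step y m)
    then obtain k where k: "y = skip i k" "(j, k) \<in> E\<^sup>*"
      by blast
    with step show ?case
      by (cases m rule: skip_cases[of _ i]) (auto intro: rtrancl_into_rtrancl)
  qed blast
next
  have "(skip i j, skip i k) \<in> (add_loop i E)\<^sup>*" if "(j, k) \<in> E\<^sup>*" for k
    using that by induction (auto intro: rtrancl_into_rtrancl simp: add_loop_iff(2))
  then show "\<exists>k. m = skip i k \<and> (j, k) \<in> E\<^sup>* \<Longrightarrow> (skip i j, m) \<in> (add_loop i E)\<^sup>*"
    by blast
qed

lemma rtrancl_add_loop_fixed: "(i, m) \<in> (add_loop i E)\<^sup>* \<longleftrightarrow> m = i"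
proof
  assume "(i, m) \<in> (add_loop i E)\<^sup>*"
  then show "m = i"
    by induction (metis add_loop_iff(4) skip_cases)+
qed simp

lemma indeg_add_loop: "indeg (add_loop i E) (skip i j) = indeg E j" "indeg (add_loop i E) i = 1"
proof -
  have "{u. (u, skip i j) \<in> add_loop i E} = skip i ` {u. (u, j) \<in> E}"
    by (auto simp: image_iff) (metis add_loop_iff(2,4) skip_cases)
  then show "indeg (add_loop i E) (skip i j) = indeg E j"
    by (simp add: indeg_def card_image inj_on_def)
  have "{u. (u, i) \<in> add_loop i E} = {i}"
    by (auto) (metis add_loop_iff(3) skip_cases)
  then show "indeg (add_loop i E) i = 1"
    by (simp add: indeg_def)
qed

lemma outdeg_add_loop: "outdeg (add_loop i E) (skip i j) = outdeg E j" "outdeg (add_loop i E) i = 1"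
  by (simp_all only: outdeg_eq_indeg_converse add_loop_converse indeg_add_loop)

lemma atLeastAtMost_eq_insert_skip: "i \<in> {1..n} \<Longrightarrow> {1..n} = insert i (skip i ` {1..n - 1})"
  by (subst skip_image) auto

lemma skip_in_iff: "i \<in> {1..n} \<Longrightarrow> skip i j \<in> {1..n} \<longleftrightarrow> j \<in> {1..n - 1}"
  by (auto simp: skip_def)

lemma chains_add_loop:
  assumes i: "i \<in> {1..n}"
  shows "chains n (add_loop i E) = map_prod (skip i) (skip i) ` chains (n - 1) E"
  unfolding set_eq_iff split_paired_All
proof (intro allI)
  fix a b
  show "(a, b) \<in> chains n (add_loop i E) \<longleftrightarrow>
      (a, b) \<in> map_prod (skip i) (skip i) ` chains (n - 1) E"
    using skip_in_iff[OF i]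
    by (cases a rule: skip_cases[of _ i]; cases b rule: skip_cases[of _ i])
      (auto simp: chains_def indeg_add_loop outdeg_add_loop rtrancl_add_loop image_iff)
qed

lemma components_add_loop:
  assumes i: "i \<in> {1..n}"
  shows "components n (add_loop i E) = insert {i} ((`) (skip i) ` components (n - 1) E)"
proof -
  \<comment> \<open>Symmetrising commutes with adding the loop, so undirected connectivity is again
    reachability in a relation of the form \<open>add_loop i _\<close>.\<close>
  let ?R = "(add_loop i (E \<union> E\<inverse>))\<^sup>*"
  have "?R `` {i} = {i}"
    by (auto simp: rtrancl_add_loop_fixed)
  moreover have "?R `` {skip i j} = skip i ` ((E \<union> E\<inverse>)\<^sup>* `` {j})" for j
    by (auto simp: rtrancl_add_loop)
  ultimately show ?thesis
    unfolding components_def add_loop_converse add_loop_Un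
    by (subst atLeastAtMost_eq_insert_skip[OF i]) (simp add: image_image)
qed

lemma finite_components: "finite (components n E)"
  by (simp add: components_def)

text \<open>The loop counts once in and once out, so the new component \<open>{i}\<close> has degree
  2 and is a cycle; the other components are relabelled with unchanged degrees.\<close>

lemma card_cycles_add_loop:
  assumes i: "i \<in> {1..n}"
  shows "card (cycles n (add_loop i E)) = Suc (card (cycles (n - 1) E))"
proof -
  have "cycles n (add_loop i E) = insert {i} ((`) (skip i) ` cycles (n - 1) E)"
    unfolding cycles_def components_add_loop[OF i]
    by (auto simp: degree_in_def indeg_add_loop outdeg_add_loop)
  moreover have "{i} \<notin> (`) (skip i) ` cycles (n - 1) E"
    by auto
  moreover have "finite (cycles (n - 1) E)"
    by (simp add: cycles_def finite_components)
  moreover have "inj ((`) (skip i))"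
    by (intro injI) (metis inj_image_eq_iff inj_skip)
  ultimately show ?thesis
    by (simp add: card_image inj_on_subset)
qed

section \<open>The Schwarzian derivative and the double pole\<close>

text \<open>One step of Taylor expansion with exact remainder: the difference quotient extends
  holomorphically over \<open>w\<close>. Iterating it on the cofactor produces the Taylor
  coefficients, and the clause on higher derivatives identifies them with derivatives of
  \<open>f\<close> at \<open>w\<close>.\<close>

lemma holomorphic_factor:
  fixes f :: "complex \<Rightarrow> complex"
  assumes "f holomorphic_on S" "open S" "w \<in> S"
  obtains g where "g holomorphic_on S" "\<And>u. f u = f w + (u - w) * g u"
    "\<And>k. (deriv ^^ Suc k) f w = of_nat (Suc k) * (deriv ^^ k) g w"
    "\<And>u. u \<in> S \<Longrightarrow> deriv f u = g u + (u - w) * deriv g u"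
proof -
  define g where "g u = (if u = w then deriv f w else (f u - f w) / (u - w))" for u
  have g: "g holomorphic_on S"
    unfolding g_def using pole_lemma_open[OF assms(1,2)] .
  have fg: "f u = f w + (u - w) * g u" for u
    by (simp add: g_def)
  have dg: "((deriv ^^ k) g has_field_derivative (deriv ^^ Suc k) g u) (at u)" if "u \<in> S" for k u
    using holomorphic_derivI[OF holomorphic_higher_deriv[OF g assms(2)] assms(2) that] by simp
  \<comment> \<open>This is the Leibniz rule for \<open>(u - w) * g u\<close>. It is proved on all
    of \<open>S\<close>, because the next differentiation needs it near the point; at
    \<open>u = w\<close> the last summand vanishes.\<close>
  have "\<forall>u\<in>S. (deriv ^^ Suc k) f u = of_nat (Suc k) * (deriv ^^ k) g u + (u - w) * (deriv ^^ Suc k) g u"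
    for k
  proof (induction k)
    case 0
    have "((\<lambda>u. f w + (u - w) * g u) has_field_derivative g u + (u - w) * deriv g u) (at u)"
      if "u \<in> S" for u
      using dg[OF that, of 0] by (auto intro!: derivative_eq_intros)
    then have "(f has_field_derivative g u + (u - w) * deriv g u) (at u)" if "u \<in> S" for u
      using that by (simp only: fg[symmetric])
    then show ?case
      by (simp add: DERIV_imp_deriv)
  next
    case (Suc k)
    let ?h = "\<lambda>u. of_nat (Suc k) * (deriv ^^ k) g u + (u - w) * (deriv ^^ Suc k) g u"
    have "(deriv ^^ Suc (Suc k)) f u =
        of_nat (Suc (Suc k)) * (deriv ^^ Suc k) g u + (u - w) * (deriv ^^ Suc (Suc k)) g u"
      if u: "u \<in> S" for u
    proof -
      have "(?h has_field_derivative
          of_nat (Suc k) * (deriv ^^ Suc k) g u + ((deriv ^^ Suc k) g u + (u - w) * (deriv ^^ Suc (Suc k)) g u))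
          (at u)"
        by (rule derivative_eq_intros dg[OF u] refl | simp only: diff_zero mult_1)+ (simp add: algebra_simps)
      then have "deriv ?h u = of_nat (Suc (Suc k)) * (deriv ^^ Suc k) g u + (u - w) * (deriv ^^ Suc (Suc k)) g u"
        by (simp add: DERIV_imp_deriv algebra_simps)
      moreover have "deriv ((deriv ^^ Suc k) f) u = deriv ?h u"
        by (rule deriv_cong_ev[OF _ refl]) (use Suc.IH u assms(2) in \<open>auto simp: eventually_nhds\<close>)
      ultimately show ?thesis
        by simp
    qed
    then show ?case
      by blast
  qed
  note higher = this
  show thesis
  proof (rule that[OF g fg])
    show "(deriv ^^ Suc k) f w = of_nat (Suc k) * (deriv ^^ k) g w" for k
      using higher[of k] assms(3) by simp
    show "deriv f u = g u + (u - w) * deriv g u" if "u \<in> S" for u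
      using higher[of 0] that by simp
  qed
qed

lemma bigo_of_continuous_factor:
  fixes g :: "complex \<Rightarrow> complex"
  assumes "isCont g w" "eventually (\<lambda>u. f u = (w - u) * g u) (at w)"
  shows "f \<in> O[at w](\<lambda>u. w - u)"
proof -
  have "g \<in> O[at w](\<lambda>_. 1)"
    by (rule bigoI_tendsto[where c = "g w"]) (use assms(1) in \<open>simp_all add: isCont_def\<close>)
  then have "(\<lambda>u. (w - u) * g u) \<in> O[at w](\<lambda>u. (w - u) * 1)"
    by (intro landau_o.big.mult) simp_all
  then show ?thesis
    using landau_o.big.in_cong[OF assms(2)] by simp
qed

text \<open>With \<open>h = u - w\<close> and \<open>\<phi> u = \<phi> w + h q\<close>, \<open>q = a1 + a2 h + a3 h\<^sup>2 + O(h\<^sup>3)\<close>, the Schwarzian at \<open>w\<close> is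
  \<open>6 (a3 / a1 - (a2 / a1)\<^sup>2)\<close>, and the claim is the vanishing of the terms of order below 3 of
  \<open>a1 \<phi>' u - (1 + S h\<^sup>2 / 6) q\<^sup>2\<close>.\<close>

lemma schwarzian_double_pole:
  fixes \<phi> :: "complex \<Rightarrow> complex"
  assumes hol: "\<phi> holomorphic_on S" and S: "open S" and inj: "inj_on \<phi> S" and w: "w \<in> S"
  shows "(\<lambda>u. deriv \<phi> w * deriv \<phi> u / (\<phi> w - \<phi> u)\<^sup>2 - (1 / (w - u)\<^sup>2 + schwarzian \<phi> w / 6))
           \<in> O[at w](\<lambda>u. w - u)"
proof -
  obtain q where q: "q holomorphic_on S" "\<And>u. \<phi> u = \<phi> w + (u - w) * q u"
    "\<And>k. (deriv ^^ Suc k) \<phi> w = of_nat (Suc k) * (deriv ^^ k) q w"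
    "\<And>u. u \<in> S \<Longrightarrow> deriv \<phi> u = q u + (u - w) * deriv q u"
    by (rule holomorphic_factor[OF hol S w]) blast
  obtain q1 where q1: "q1 holomorphic_on S" "\<And>u. q u = q w + (u - w) * q1 u"
    "\<And>k. (deriv ^^ Suc k) q w = of_nat (Suc k) * (deriv ^^ k) q1 w"
    "\<And>u. u \<in> S \<Longrightarrow> deriv q u = q1 u + (u - w) * deriv q1 u"
    by (rule holomorphic_factor[OF q(1) S w]) blast
  obtain q2 where q2: "q2 holomorphic_on S" "\<And>u. q1 u = q1 w + (u - w) * q2 u"
    "\<And>k. (deriv ^^ Suc k) q1 w = of_nat (Suc k) * (deriv ^^ k) q2 w"
    "\<And>u. u \<in> S \<Longrightarrow> deriv q1 u = q2 u + (u - w) * deriv q2 u"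
    by (rule holomorphic_factor[OF q1(1) S w]) blast
  obtain q3 where q3: "q3 holomorphic_on S" "\<And>u. q2 u = q2 w + (u - w) * q3 u"
    by (rule holomorphic_factor[OF q2(1) S w]) blast
  define a1 a2 a3 where "a1 = q w" and "a2 = q1 w" and "a3 = q2 w"
  define s where "s = schwarzian \<phi> w / 6"
  have d1: "deriv \<phi> w = a1"
    using q(4)[OF w] by (simp add: a1_def)
  have a1: "a1 \<noteq> 0"
    using holomorphic_injective_imp_regular[OF hol S inj w] d1 by simp
  have d2: "(deriv ^^ 2) \<phi> w = 2 * a2"
    using q(3)[of 1] q1(3)[of 0] by (simp add: a2_def numeral_2_eq_2)
  have d3: "(deriv ^^ 3) \<phi> w = 6 * a3"
    using q(3)[of 2] q1(3)[of 1] q2(3)[of 0] by (simp add: a3_def numeral_2_eq_2 numeral_3_eq_3)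
  have s: "a1\<^sup>2 * s = a1 * a3 - a2\<^sup>2"
    using a1 unfolding s_def schwarzian_def d1 d2 d3 by (simp add: field_simps power2_eq_square)
  \<comment> \<open>Here \<open>\<phi>' u = a1 + 2 * a2 * h + 3 * a3 * h\<^sup>2 + h ^ 3 * r
    u\<close>. Accordingly \<open>M\<close> gathers what remains of
    \<open>a1 * \<phi>' u - (1 + s * h\<^sup>2) * (q u)\<^sup>2\<close> after division by
    \<open>h ^ 3\<close>: the terms of order 0 and 1 cancel identically, and the coefficient of
    \<open>h\<^sup>2\<close> is \<open>a1 * a3 - a2\<^sup>2 - a1\<^sup>2 * s\<close>, which is
    0.\<close>
  define r where "r u = 3 * q3 u + deriv q2 u" for u
  define M where "M u = a1 * r u - 2 * a2 * a3 - a3\<^sup>2 * (u - w)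
      - 2 * (a1 + a2 * (u - w) + a3 * (u - w)\<^sup>2) * q3 u - (u - w) ^ 3 * (q3 u)\<^sup>2
      - s * (2 * a1 * q1 u + (u - w) * (q1 u)\<^sup>2)" for u
  have num: "a1 * deriv \<phi> u - (1 + (u - w)\<^sup>2 * s) * (q u)\<^sup>2 = (u - w) ^ 3 * M u" if u: "u \<in> S" for u
  proof -
    define h where "h = u - w"
    have qu: "q2 u = a3 + h * q3 u" "q1 u = a2 + h * q2 u" "q u = a1 + h * q1 u"
      using q3(2)[of u] q2(2)[of u] q1(2)[of u] by (simp_all add: a1_def a2_def a3_def h_def)
    have d: "deriv \<phi> u = q u + h * (q1 u + h * (q2 u + h * deriv q2 u))"
      using q(4)[OF u] q1(4)[OF u] q2(4)[OF u] by (simp add: h_def)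
    have "a1 * deriv \<phi> u - (1 + h\<^sup>2 * s) * (q u)\<^sup>2 - h ^ 3 * M u = h\<^sup>2 * (a1 * a3 - a2\<^sup>2 - a1\<^sup>2 * s)"
      unfolding d M_def r_def h_def[symmetric] qu
      by (simp add: algebra_simps power2_eq_square power3_eq_cube)
    then show ?thesis
      using s by (simp add: h_def)
  qed
  have cont: "isCont g w" if "g holomorphic_on S" for g
    using that S w by (metis continuous_on_eq_continuous_at holomorphic_on_imp_continuous_on)
  have dq2: "deriv q2 holomorphic_on S"
    using q2(1) S by (rule holomorphic_deriv)
  have "isCont M w"
    unfolding M_def r_def by (intro continuous_intros cont q1(1) q3(1) dq2)
  \<comment> \<open>The minus sign passes from powers of \<open>u - w\<close> to the comparison
    function \<open>w - u\<close>.\<close>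
  then have "isCont (\<lambda>u. - M u / (q u)\<^sup>2) w"
    using a1 cont[OF q(1)] by (intro continuous_intros) (simp_all add: a1_def)
  moreover have "eventually (\<lambda>u. deriv \<phi> w * deriv \<phi> u / (\<phi> w - \<phi> u)\<^sup>2 - (1 / (w - u)\<^sup>2 + s) =
      (w - u) * (- M u / (q u)\<^sup>2)) (at w)"
  proof -
    have "eventually (\<lambda>u. u \<in> S - {w}) (at w)"
      using S w by (rule eventually_at_in_open)
    then show ?thesis
    proof eventually_elim
      case (elim u)
      \<comment> \<open>A zero of \<open>q\<close> at \<open>u\<close> would give
        \<open>\<phi> u = \<phi> w\<close>, against injectivity.\<close>
      then have qn: "q u \<noteq> 0" and h: "u - w \<noteq> 0"
        using q(2)[of u] inj w by (auto simp: inj_on_def)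
      have "(\<phi> w - \<phi> u)\<^sup>2 = (u - w)\<^sup>2 * (q u)\<^sup>2"
        using q(2)[of u] by (simp add: power_mult_distrib)
      moreover have "(w - u)\<^sup>2 = (u - w)\<^sup>2"
        by (rule power2_commute)
      moreover have "a1 * deriv \<phi> u = (1 + (u - w)\<^sup>2 * s) * (q u)\<^sup>2 + (u - w) ^ 3 * M u"
        using num[of u] elim by (simp add: algebra_simps)
      moreover have "((1 + h\<^sup>2 * s) * Q\<^sup>2 + h ^ 3 * m) / (h\<^sup>2 * Q\<^sup>2) - (1 / h\<^sup>2 + s) = h * m / Q\<^sup>2"
        if "h \<noteq> 0" "Q \<noteq> 0" for h Q m :: complex
        using that by (simp add: field_simps power2_eq_square power3_eq_cube)
      ultimately have "deriv \<phi> w * deriv \<phi> u / (\<phi> w - \<phi> u)\<^sup>2 - (1 / (w - u)\<^sup>2 + s) = (u - w) * M u / (q u)\<^sup>2"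
        using qn h by (simp add: d1)
      also have "\<dots> = (w - u) * (- M u / (q u)\<^sup>2)"
        by (simp add: algebra_simps diff_divide_distrib)
      finally show ?case .
    qed
  qed
  ultimately show ?thesis
    unfolding s_def by (rule bigo_of_continuous_factor)
qed


section \<open>Composing a local coordinate with a conformal map\<close>

lemma chart_facts:
  assumes "is_chart X (U, x)"
  shows "openin X U" "open (x ` U)" "inj_on x U"
proof -
  show "openin X U" "open (x ` U)"
    using assms by (auto simp: is_chart_def)
  then have "topspace (subtopology X U) = U"
    using openin_subset[of X U] by auto
  then show "inj_on x U"
    using assms homeomorphic_imp_injective_map by (fastforce simp: is_chart_def)
qed

lemma chart_inv_apply: "is_chart X (U, x) \<Longrightarrow> q \<in> U \<Longrightarrow> chart_inv (U, x) (x q) = q"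
  by (simp add: chart_inv_def chart_facts(3))

locale conformal_recoordinatisation =
  fixes X :: "'a topology" and \<A> :: "'a chart set" and U :: "'a set"
    and x :: "'a \<Rightarrow> complex" and \<phi> :: "complex \<Rightarrow> complex"
  assumes atlas: "compact_riemann_surface X \<A>"
    and lc: "local_coord X \<A> (U, x)"
    and hol: "\<phi> holomorphic_on x ` U" and inj: "inj_on \<phi> (x ` U)"
begin

lemma chart: "is_chart X (U, x)"
  using lc by (simp add: local_coord_def)

lemmas openin_U = chart_facts(1)[OF chart]
  and open_xU = chart_facts(2)[OF chart]
  and inj_x = chart_facts(3)[OF chart]

lemma inj_new: "inj_on (\<phi> \<circ> x) U"
  using inj inj_x by (simp add: comp_inj_on)

lemma is_chart_new: "is_chart X (U, \<phi> \<circ> x)"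
proof -
  have "homeomorphic_map (top_of_set (x ` U)) (top_of_set (\<phi> ` x ` U)) \<phi>"
  proof -
    obtain g where "homeomorphism (x ` U) (\<phi> ` x ` U) \<phi> g"
      using invariance_of_domain_homeomorphism[OF open_xU holomorphic_on_imp_continuous_on[OF hol] _ inj]
      by auto
    then have "homeomorphic_maps (top_of_set (x ` U)) (top_of_set (\<phi> ` x ` U)) \<phi> g"
      by (auto simp: homeomorphism_def homeomorphic_maps_def)
    then show ?thesis
      by (auto simp: homeomorphic_map_maps)
  qed
  moreover have "homeomorphic_map (subtopology X U) (top_of_set (x ` U)) x"
    using chart by (simp add: is_chart_def)
  ultimately have "homeomorphic_map (subtopology X U) (top_of_set (\<phi> ` x ` U)) (\<phi> \<circ> x)"
    by (rule homeomorphic_map_compose[rotated])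
  moreover have "open (\<phi> ` x ` U)"
    using open_mapping_thm3[OF hol open_xU inj] .
  ultimately show ?thesis
    using openin_U by (simp add: is_chart_def image_comp)
qed

lemma chart_inv_new: "u \<in> x ` U \<Longrightarrow> chart_inv (U, \<phi> \<circ> x) (\<phi> u) = chart_inv (U, x) u"
  using inj_new inj_x by (auto simp: chart_inv_def dest: inv_into_f_f)

lemma local_coord_new: "local_coord X \<A> (U, \<phi> \<circ> x)"
  unfolding local_coord_def
proof (intro conjI ballI is_chart_new)
  fix d assume d: "d \<in> \<A>"
  obtain V y where Vy: "d = (V, y)"
    by (cases d)
  have "is_chart X (V, y)"
    using atlas d by (auto simp: compact_riemann_surface_def Vy)
  then have inj_y: "inj_on y V"
    by (rule chart_facts)
  have comp: "transition (U, x) d holomorphic_on x ` (U \<inter> V)"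
      "transition d (U, x) holomorphic_on y ` (U \<inter> V)"
    using lc d by (auto simp: local_coord_def compatible_def Vy)
  \<comment> \<open>With the holomorphic inverse \<psi> of \<phi>, the transition from the new chart
    to \<open>d\<close> is the old transition precomposed with \<psi>.\<close>
  obtain \<psi> where \<psi>: "\<psi> holomorphic_on \<phi> ` x ` U" "\<And>u. u \<in> x ` U \<Longrightarrow> \<psi> (\<phi> u) = u"
    using holomorphic_has_inverse[OF hol open_xU inj] by metis
  have "\<psi> holomorphic_on (\<phi> \<circ> x) ` (U \<inter> V)"
    using \<psi>(1) by (rule holomorphic_on_subset) auto
  moreover have "\<psi> ` (\<phi> \<circ> x) ` (U \<inter> V) = x ` (U \<inter> V)"
    using \<psi>(2) by (force simp: image_iff)
  ultimately have "transition (U, x) d \<circ> \<psi> holomorphic_on (\<phi> \<circ> x) ` (U \<inter> V)"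
    using comp(1) by (intro holomorphic_on_compose) simp_all
  then have "transition (U, \<phi> \<circ> x) d holomorphic_on (\<phi> \<circ> x) ` (U \<inter> V)"
    by (rule holomorphic_transform) (auto simp: transition_def \<psi>(2) chart_inv_new)
  moreover have "\<phi> \<circ> transition d (U, x) holomorphic_on y ` (U \<inter> V)"
  proof (rule holomorphic_on_compose[OF comp(2)])
    have "transition d (U, x) ` y ` (U \<inter> V) \<subseteq> x ` U"
      using inj_y by (auto simp: transition_def chart_inv_def Vy)
    then show "\<phi> holomorphic_on transition d (U, x) ` y ` (U \<inter> V)"
      by (rule holomorphic_on_subset[OF hol])
  qed
  ultimately show "compatible (U, \<phi> \<circ> x) d"
    by (simp add: compatible_def transition_def Vy comp_assoc)
qed

lemma deriv_transition_new:
  assumes "q \<in> U"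
  shows "deriv (transition (U, x) (U, \<phi> \<circ> x)) (x q) = deriv \<phi> (x q)"
proof (rule deriv_cong_ev[OF _ refl])
  have "eventually (\<lambda>u. u \<in> x ` U) (nhds (x q))"
    using assms open_xU by (intro eventually_nhds_in_open) auto
  then show "eventually (\<lambda>u. transition (U, x) (U, \<phi> \<circ> x) u = \<phi> u) (nhds (x q))"
    by eventually_elim (auto simp: transition_def chart_inv_apply[OF chart])
qed

lemma holomorphic_differential_new:
  assumes "holomorphic_differential X \<A> \<eta>" "q \<in> U"
  shows "\<eta> (U, x) q = deriv \<phi> (x q) * \<eta> (U, \<phi> \<circ> x) q"
proof -
  have "q \<in> fst (U, x) \<inter> fst (U, \<phi> \<circ> x)"
    using assms(2) by simp
  then have "\<eta> (U, x) q = \<eta> (U, \<phi> \<circ> x) q * deriv (transition (U, x) (U, \<phi> \<circ> x)) (snd (U, x) q)"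
    using assms(1) lc local_coord_new unfolding holomorphic_differential_def by blast
  then show ?thesis
    by (simp add: deriv_transition_new[OF assms(2)])
qed

end

section \<open>Transformation of the bidifferential and of its projective connection\<close>

lemma deriv_transition_self:
  assumes "is_chart X c" "q \<in> fst c"
  shows "deriv (transition c c) (snd c q) = 1"
proof -
  obtain U x where c: "c = (U, x)"
    by (cases c)
  have "eventually (\<lambda>u. u \<in> x ` U) (nhds (x q))"
    using assms chart_facts(2)[of X U x] by (intro eventually_nhds_in_open) (auto simp: c)
  then have "eventually (\<lambda>u. transition c c u = u) (nhds (x q))"
    by eventually_elim (use assms(1) in \<open>auto simp: c transition_def chart_inv_apply\<close>)
  then have "deriv (transition c c) (x q) = deriv (\<lambda>u. u) (x q)"
    by (rule deriv_cong_ev) simp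
  then show ?thesis
    by (simp add: c)
qed

text \<open>Two candidates differ by a constant that is \<open>O(w - u)\<close>, hence by 0. This is
  what gives the definite description in \<open>proj_conn\<close> its value.\<close>

lemma diagonal_term_unique:
  assumes "diagonal_term \<omega> c p \<sigma>" "diagonal_term \<omega> c p \<sigma>'"
  shows "\<sigma> = \<sigma>'"
proof -
  let ?w = "snd c p"
  have "(\<lambda>u. (\<sigma>' - \<sigma>) / 6) \<in> O[at ?w](\<lambda>u. ?w - u)"
    using sum_in_bigo(2)[OF assms[unfolded diagonal_term_def]] by (simp add: diff_divide_distrib)
  then obtain C where "eventually (\<lambda>u. norm ((\<sigma>' - \<sigma>) / 6) \<le> C * norm (?w - u)) (at ?w)"
    by (elim landau_o.bigE)
  moreover have "((\<lambda>u. C * norm (?w - u)) \<longlongrightarrow> C * norm (?w - ?w)) (at ?w)"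
    by (intro tendsto_intros)
  ultimately have "norm ((\<sigma>' - \<sigma>) / 6) \<le> C * norm (?w - ?w)"
    by (intro tendsto_lowerbound) auto
  then show ?thesis
    by simp
qed

lemma proj_conn_eq: "diagonal_term \<omega> c p \<sigma> \<Longrightarrow> proj_conn \<omega> c p = \<sigma>"
  unfolding proj_conn_def by (rule the_equality) (auto dest: diagonal_term_unique)

context conformal_recoordinatisation
begin

text \<open>Each slot is changed separately, the untouched one contributing the trivial factor 1. A
  single edge at the moved point needs one slot; the diagonal expansion uses both in
  succession.\<close>

lemma bidifferential_new:
  assumes \<omega>: "normalised_bidifferential X \<A> a \<omega>" and p: "p \<in> U"
    and e: "local_coord X \<A> e" "q \<in> fst e" and "p \<noteq> q"
  shows "\<omega> (U, x) e p q = deriv \<phi> (x p) * \<omega> (U, \<phi> \<circ> x) e p q"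
    and "\<omega> e (U, x) q p = deriv \<phi> (x p) * \<omega> e (U, \<phi> \<circ> x) q p"
proof -
  have trans: "\<omega> c d p q = \<omega> c' d' p q * deriv (transition c c') (snd c p) * deriv (transition d d') (snd d q)"
    if "local_coord X \<A> c" "local_coord X \<A> c'" "local_coord X \<A> d" "local_coord X \<A> d'"
      "p \<in> fst c \<inter> fst c'" "q \<in> fst d \<inter> fst d'" "p \<noteq> q" for c c' d d' p q
    using \<omega> that unfolding normalised_bidifferential_def by blast
  have self: "deriv (transition e e) (snd e q) = 1"
    using e by (intro deriv_transition_self) (auto simp: local_coord_def)
  show "\<omega> (U, x) e p q = deriv \<phi> (x p) * \<omega> (U, \<phi> \<circ> x) e p q"
    using trans[OF lc local_coord_new e(1) e(1), of p q] assms
    by (simp add: self deriv_transition_new)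
  show "\<omega> e (U, x) q p = deriv \<phi> (x p) * \<omega> e (U, \<phi> \<circ> x) q p"
    using trans[OF e(1) e(1) lc local_coord_new, of q p] assms
    by (simp add: self deriv_transition_new)
qed

text \<open>Since only the second point moves, the new expansion is multiplied by
  \<open>\<phi>' w * \<phi>' u\<close>. Three errors result, each \<open>O(w - u)\<close>: the
  pulled back remainder, the transformed double pole minus its principal part and Schwarzian
  constant, and the replacement of \<open>\<phi>' u\<close> by \<open>\<phi>' w\<close> in front of
  \<open>\<sigma> / 6\<close>.\<close>

lemma diagonal_term_new:
  assumes \<omega>: "normalised_bidifferential X \<A> a \<omega>" and p: "p \<in> U"
    and diag: "diagonal_term \<omega> (U, \<phi> \<circ> x) p \<sigma>"
  shows "diagonal_term \<omega> (U, x) p ((deriv \<phi> (x p))\<^sup>2 * \<sigma> + schwarzian \<phi> (x p))"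
proof -
  define w where "w = x p"
  let ?S = "x ` U"
  have w: "w \<in> ?S"
    using p by (simp add: w_def)
  have cont: "isCont g w" if "g holomorphic_on ?S" for g
    using that open_xU w by (metis continuous_on_eq_continuous_at holomorphic_on_imp_continuous_on)
  have lin: "(\<lambda>u. f w - f u) \<in> O[at w](\<lambda>u. w - u)" if f: "f holomorphic_on ?S" for f
  proof -
    obtain g where g: "g holomorphic_on ?S" "\<And>u. f u = f w + (u - w) * g u"
      by (rule holomorphic_factor[OF f open_xU w]) blast
    have "f w - f u = (w - u) * g u" for u
      using g(2)[of u] by (simp add: algebra_simps)
    then show ?thesis
      by (intro bigo_of_continuous_factor[OF cont[OF g(1)]]) simp
  qed
  have d\<phi>: "deriv \<phi> holomorphic_on ?S"
    using hol open_xU by (rule holomorphic_deriv)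
  have ev: "eventually (\<lambda>u. u \<in> ?S - {w}) (at w)"
    using open_xU w by (rule eventually_at_in_open)
  \<comment> \<open>Substituting \<phi> into an estimate on a punctured neighbourhood of
    \<open>\<phi> w\<close> requires that \<phi> avoid the value \<open>\<phi> w\<close> near
    \<open>w\<close>.\<close>
  have "eventually (\<lambda>u. \<phi> u \<noteq> \<phi> w) (at w)"
    using ev by eventually_elim (use inj w in \<open>auto simp: inj_on_def\<close>)
  then have lim: "filterlim \<phi> (at (\<phi> w)) (at w)"
    using cont[OF hol] by (simp add: filterlim_at isCont_def)
  define r where "r v = \<omega> (U, \<phi> \<circ> x) (U, \<phi> \<circ> x) p (chart_inv (U, \<phi> \<circ> x) v)
      - (1 / (\<phi> w - v)\<^sup>2 + \<sigma> / 6)" for v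
  have "r \<in> O[at (\<phi> w)](\<lambda>v. \<phi> w - v)"
    using diag by (simp add: diagonal_term_def r_def[abs_def] w_def)
  then have "(\<lambda>u. r (\<phi> u)) \<in> O[at w](\<lambda>u. \<phi> w - \<phi> u)"
    using lim by (rule landau_o.big.compose)
  then have r: "(\<lambda>u. r (\<phi> u)) \<in> O[at w](\<lambda>u. w - u)"
    using lin[OF hol] by (rule landau_o.big_trans)
  have "(\<lambda>u. deriv \<phi> w * deriv \<phi> u) \<in> O[at w](\<lambda>_. 1)"
    by (rule bigoI_tendsto[where c = "deriv \<phi> w * deriv \<phi> w"])
      (use cont[OF d\<phi>] in \<open>auto simp: isCont_def intro!: tendsto_intros\<close>)
  from landau_o.big.mult[OF this r]
  have t1: "(\<lambda>u. deriv \<phi> w * deriv \<phi> u * r (\<phi> u)) \<in> O[at w](\<lambda>u. w - u)"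
    by simp
  have t2: "(\<lambda>u. deriv \<phi> w * deriv \<phi> u / (\<phi> w - \<phi> u)\<^sup>2 - (1 / (w - u)\<^sup>2 + schwarzian \<phi> w / 6))
           \<in> O[at w](\<lambda>u. w - u)"
    by (rule schwarzian_double_pole[OF hol open_xU inj w])
  have "(\<lambda>u. deriv \<phi> w * \<sigma> / 6) \<in> O[at w](\<lambda>_. 1)"
    by (rule bigoI_tendsto[where c = "deriv \<phi> w * \<sigma> / 6"]) auto
  from landau_o.big.mult[OF this lin[OF d\<phi>]]
  have t3: "(\<lambda>u. deriv \<phi> w * \<sigma> / 6 * (deriv \<phi> w - deriv \<phi> u)) \<in> O[at w](\<lambda>u. w - u)"
    by simp
  have "eventually (\<lambda>u. \<omega> (U, x) (U, x) p (chart_inv (U, x) u)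
        - (1 / (w - u)\<^sup>2 + ((deriv \<phi> w)\<^sup>2 * \<sigma> + schwarzian \<phi> w) / 6) =
      deriv \<phi> w * deriv \<phi> u * r (\<phi> u)
        + (deriv \<phi> w * deriv \<phi> u / (\<phi> w - \<phi> u)\<^sup>2 - (1 / (w - u)\<^sup>2 + schwarzian \<phi> w / 6))
        - deriv \<phi> w * \<sigma> / 6 * (deriv \<phi> w - deriv \<phi> u)) (at w)"
    using ev
  proof eventually_elim
    case (elim u)
    then obtain q where q: "q \<in> U" "u = x q" "p \<noteq> q"
      by (auto simp: w_def)
    have "\<omega> (U, x) (U, x) p q = deriv \<phi> w * deriv \<phi> u * \<omega> (U, \<phi> \<circ> x) (U, \<phi> \<circ> x) p q"
      using bidifferential_new(1)[OF \<omega> p lc, of q] bidifferential_new(2)[OF \<omega> q(1) local_coord_new, of p] p q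
      by (simp add: w_def)
    moreover have "chart_inv (U, x) u = q" "chart_inv (U, \<phi> \<circ> x) (\<phi> u) = q"
      using chart_inv_apply[OF chart q(1)] chart_inv_new[of u] q by auto
    ultimately show ?case
      by (simp add: r_def algebra_simps add_divide_distrib diff_divide_distrib power2_eq_square)
  qed
  moreover have "(\<lambda>u. deriv \<phi> w * deriv \<phi> u * r (\<phi> u)
        + (deriv \<phi> w * deriv \<phi> u / (\<phi> w - \<phi> u)\<^sup>2 - (1 / (w - u)\<^sup>2 + schwarzian \<phi> w / 6))
        - deriv \<phi> w * \<sigma> / 6 * (deriv \<phi> w - deriv \<phi> u)) \<in> O[at w](\<lambda>u. w - u)"
    by (intro sum_in_bigo t1 t2 t3)
  ultimately show ?thesis
    unfolding diagonal_term_def snd_conv w_def[symmetric] by (simp only: landau_o.big.in_cong)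
qed

lemma proj_conn_new:
  assumes \<omega>: "normalised_bidifferential X \<A> a \<omega>" and p: "p \<in> U"
  shows "proj_conn \<omega> (U, x) p =
    (deriv \<phi> (x p))\<^sup>2 * proj_conn \<omega> (U, \<phi> \<circ> x) p + schwarzian \<phi> (x p)"
proof -
  have "p \<in> fst (U, \<phi> \<circ> x)"
    using p by simp
  then obtain \<sigma> where \<sigma>: "diagonal_term \<omega> (U, \<phi> \<circ> x) p \<sigma>"
    using \<omega> local_coord_new unfolding normalised_bidifferential_def by blast
  then show ?thesis
    using proj_conn_eq[OF diagonal_term_new[OF \<omega> p \<sigma>]] proj_conn_eq[OF \<sigma>] by simp
qed

end

section \<open>Behaviour of the graph weights\<close>

lemma alpha_const_mult: "alpha_const (a * b) = alpha_const a * alpha_const b"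
  by (simp add: alpha_const_def mult_single)

lemma alpha_const_1 [simp]: "alpha_const 1 = 1"
  by (simp add: alpha_const_def)

lemma alpha_const_power: "alpha_const (a ^ k) = alpha_const a ^ k"
  by (induction k) (simp_all add: alpha_const_mult)

lemma alpha_const_add: "alpha_const (a + b) = alpha_const a + alpha_const b"
  by (simp add: alpha_const_def single_add)

lemma lookup_alpha_const_mult: "Poly_Mapping.lookup (alpha_const k * P) m = k * Poly_Mapping.lookup P m"
  unfolding alpha_const_def mult_map_scale_conv_mult[symmetric] by (simp add: map.rep_eq when_def)

text \<open>Cancellation may shrink the support of a sum; over a common finite set of exponents
  linearity becomes termwise.\<close>

lemma alpha_to_operator_superset:
  assumes "finite K" "Poly_Mapping.keys P \<subseteq> K"
  shows "alpha_to_operator \<tau> P F = (\<Sum>m\<in>K. Poly_Mapping.lookup P m * monomial_deriv m F \<tau>)"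
  unfolding alpha_to_operator_def
  by (rule sum.mono_neutral_left) (use assms in \<open>auto simp: in_keys_iff\<close>)

lemma alpha_to_operator_linear:
  "alpha_to_operator \<tau> (alpha_const k * P + alpha_const l * Q) F =
     k * alpha_to_operator \<tau> P F + l * alpha_to_operator \<tau> Q F"
proof -
  let ?K = "Poly_Mapping.keys P \<union> Poly_Mapping.keys Q"
  have "Poly_Mapping.keys (alpha_const k * P + alpha_const l * Q) \<subseteq> ?K"
    by (auto simp: in_keys_iff lookup_add lookup_alpha_const_mult)
  then show ?thesis
    by (simp add: alpha_to_operator_superset[of ?K] lookup_add lookup_alpha_const_mult
        sum.distrib sum_distrib_left distrib_right mult.assoc)
qed

text \<open>Ends are counted, not pairs, so a degenerate chain at \<open>i\<close> yields
  \<open>k\<close> twice. The commutative monoid is the complex numbers for edges and the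
  polynomials in the \<alpha> parameters for chains.\<close>

lemma prod_endpoint_factor:
  fixes k :: "'b :: comm_monoid_mult"
  assumes "finite H"
  shows "(\<Prod>h\<in>H. (if fst h = i then k else 1) * (if snd h = i then k else 1)) =
    k ^ (card {h \<in> H. fst h = i} + card {h \<in> H. snd h = i})"
proof -
  have "(\<Prod>h\<in>H. if P h then k else 1) = k ^ card {h \<in> H. P h}" for P
    using assms by (simp add: prod.If_cases Int_def conj_commute)
  then show ?thesis
    by (simp add: prod.distrib power_add)
qed

text \<open>The vertex \<open>i\<close> contributes one factor for each edge end and one for each chain end at \<open>i\<close>; of the
  in- and out-going sides each carries exactly one edge end or chain end.\<close>

lemma graph_weight_scale_vertex:
  assumes E: "E \<in> virasoro_graphs n" and i: "i \<in> {1..n}"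
    and edge: "\<And>e. e \<in> E \<Longrightarrow> edge_weight \<omega> z e =
      (if fst e = i then k else 1) * (if snd e = i then k else 1) * edge_weight \<omega> z' e"
    and chain: "\<And>h. h \<in> chains n E \<Longrightarrow> chain_weight \<nu> z h =
      (if fst h = i then alpha_const k else 1) * (if snd h = i then alpha_const k else 1) *
      chain_weight \<nu> z' h"
  shows "graph_weight c \<omega> \<nu> n z E = alpha_const (k\<^sup>2) * graph_weight c \<omega> \<nu> n z' E"
proof -
  let ?e = "outdeg E i + indeg E i" and ?h = "(1 - indeg E i) + (1 - outdeg E i)"
  have fin: "finite E"
    using E by (rule finite_virasoro_graph)
  \<comment> \<open>The degree bounds make the truncated differences in \<open>?h\<close> exact, so
    the four counts add up to 2.\<close>
  have "indeg E i \<le> 1" "outdeg E i \<le> 1"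
    using E indeg_le_1_iff[OF fin] outdeg_le_1_iff[OF fin] by (auto simp: virasoro_graphs_iff)
  then have eh: "?e + ?h = 2"
    by simp
  have "(\<Prod>e\<in>E. edge_weight \<omega> z e) = k ^ ?e * (\<Prod>e\<in>E. edge_weight \<omega> z' e)"
    by (simp add: edge prod.distrib[of _ "edge_weight \<omega> z'"] prod_endpoint_factor[OF fin]
        card_edges_from card_edges_to)
  moreover have "(\<Prod>h\<in>chains n E. chain_weight \<nu> z h) =
      alpha_const (k ^ ?h) * (\<Prod>h\<in>chains n E. chain_weight \<nu> z' h)"
    by (simp add: chain prod.distrib[of _ "chain_weight \<nu> z'"] prod_endpoint_factor[OF finite_chains]
        card_chains_from[OF E i] card_chains_to[OF E i] alpha_const_power)
  ultimately show ?thesis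
    unfolding graph_weight_def eh[symmetric] by (simp only: power_add alpha_const_mult ac_simps)
qed

lemma prod_edges_add_loop:
  assumes "finite E"
  shows "(\<Prod>e\<in>add_loop i E. edge_weight \<omega> z e) =
    edge_weight \<omega> z (i, i) * (\<Prod>e\<in>E. edge_weight \<omega> (omit i z) e)"
proof -
  let ?s = "map_prod (skip i) (skip i)"
  have "inj ?s"
    by (rule prod.inj_map[OF inj_skip inj_skip])
  then have "(\<Prod>e\<in>?s ` E. edge_weight \<omega> z e) = (\<Prod>e\<in>E. edge_weight \<omega> z (?s e))"
    by (simp add: prod.reindex inj_on_subset)
  also have "\<dots> = (\<Prod>e\<in>E. edge_weight \<omega> (omit i z) e)"
    by (rule prod.cong) (auto simp: edge_weight_def omit_eq_skip)
  finally show ?thesis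
    using assms unfolding add_loop_def by (subst prod.insert) auto
qed

text \<open>The loop brings one cycle, hence \<open>c / 2\<close>, and one edge. It occupies both
  sides of \<open>i\<close>, so no chain ends there and the cofactor is free of
  \<open>z i\<close>.\<close>

lemma graph_weight_add_loop:
  assumes "finite E" and i: "i \<in> {1..n}"
  shows "graph_weight c \<omega> \<nu> n z (add_loop i E) =
    alpha_const (c / 2 * edge_weight \<omega> z (i, i)) * graph_weight c \<omega> \<nu> (n - 1) (omit i z) E"
proof -
  let ?s = "map_prod (skip i) (skip i)"
  have "inj ?s"
    by (rule prod.inj_map[OF inj_skip inj_skip])
  then have "(\<Prod>h\<in>chains n (add_loop i E). chain_weight \<nu> z h) =
      (\<Prod>h\<in>chains (n - 1) E. chain_weight \<nu> z (?s h))"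
    by (simp add: chains_add_loop[OF i] prod.reindex inj_on_subset)
  also have "\<dots> = (\<Prod>h\<in>chains (n - 1) E. chain_weight \<nu> (omit i z) h)"
    by (rule prod.cong) (auto simp: chain_weight_def omit_eq_skip)
  finally show ?thesis
    unfolding graph_weight_def prod_edges_add_loop[OF assms(1)] card_cycles_add_loop[OF i]
    by (simp only: power_Suc alpha_const_mult ac_simps)
qed

lemma omit_update [simp]: "omit i (z(i := v)) = omit i z"
  by (auto simp: omit_def)

section \<open>Transformation law of the operator, assembled graph by graph\<close>

theorem proposition4p1:
  fixes X :: "'a topology" and \<A> :: "'a chart set"
    and a b :: "nat \<Rightarrow> real \<Rightarrow> 'a"
    and \<omega> :: "'a bidiff" and \<nu> :: "nat \<Rightarrow> 'a chart \<Rightarrow> 'a \<Rightarrow> complex"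
    and c :: complex and n i :: nat
    and z :: "nat \<Rightarrow> 'a insertion"
    and \<phi> :: "complex \<Rightarrow> complex"
    and U :: "'a set" and x :: "'a \<Rightarrow> complex" and p :: 'a
    and F :: "complex ^ 3 \<Rightarrow> complex" and W :: "(complex ^ 3) set"
  assumes surface: "genus_two_surface X \<A> a b \<omega> \<nu>"
    and n: "n \<ge> 1"
    and insertions: "\<And>j. j \<in> {1..n} \<Longrightarrow> local_coord X \<A> (fst (z j)) \<and> snd (z j) \<in> fst (fst (z j))"
    and distinct_points: "inj_on (\<lambda>j. snd (z j)) {1..n}"
    and i: "i \<in> {1..n}" and zi: "z i = ((U, x), p)"
    and coordinate_change: "\<phi> holomorphic_on x ` U" "inj_on \<phi> (x ` U)"
    and F: "open W" "period_point X \<A> b \<nu> \<in> W" "holomorphic_several F W"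
  shows "virasoro_operator X \<A> b \<omega> \<nu> c n z F =
           (deriv \<phi> (x p))\<^sup>2 * virasoro_operator X \<A> b \<omega> \<nu> c n (z(i := change_coord \<phi> (z i))) F
           + c / 12 * schwarzian \<phi> (x p) * virasoro_operator X \<A> b \<omega> \<nu> c (n - 1) (omit i z) F"
proof -
  define z' where "z' = z(i := change_coord \<phi> (z i))"
  define k where "k = deriv \<phi> (x p)"
  define S where "S = schwarzian \<phi> (x p)"
  define \<tau> where "\<tau> = period_point X \<A> b \<nu>"
  let ?op = "\<lambda>P. alpha_to_operator \<tau> P F"
  let ?w = "graph_weight c \<omega> \<nu> n z" and ?w' = "graph_weight c \<omega> \<nu> n z'"
  let ?w1 = "graph_weight c \<omega> \<nu> (n - 1) (omit i z)"
  have p: "p \<in> U" and lc: "local_coord X \<A> (U, x)"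
    using insertions[OF i] by (auto simp: zi)
  interpret conformal_recoordinatisation X \<A> U x \<phi>
    using surface lc coordinate_change by unfold_locales (auto simp: genus_two_surface_def)
  have \<omega>: "normalised_bidifferential X \<A> a \<omega>"
    using surface by (simp add: genus_two_surface_def)
  have z'i: "z' i = ((U, \<phi> \<circ> x), p)" and z'j: "\<And>j. j \<noteq> i \<Longrightarrow> z' j = z j"
    by (auto simp: z'_def zi change_coord_def)
  have \<nu>: "\<nu> m (fst (z j)) (snd (z j)) = (if j = i then k else 1) * \<nu> m (fst (z' j)) (snd (z' j))"
    if "m \<in> {1, 2}" for m j
  proof -
    have "holomorphic_differential X \<A> (\<nu> m)"
      using surface that by (auto simp: genus_two_surface_def b_period_differentials_def)
    from holomorphic_differential_new[OF this p] show ?thesis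
      by (simp add: zi z'i z'j k_def)
  qed
  have chain: "chain_weight \<nu> z h =
      (if fst h = i then alpha_const k else 1) * (if snd h = i then alpha_const k else 1) *
      chain_weight \<nu> z' h" for h
  proof -
    obtain l m where h: "h = (l, m)"
      by (cases h)
    define s where "s = (if l = i then k else 1) * (if m = i then k else 1)"
    have "chain_weight \<nu> z h = alpha_const s * chain_weight \<nu> z' h"
      unfolding chain_weight_def h prod.case sum_distrib_left
    proof (rule sum.cong[OF refl], clarify)
      fix a b :: nat assume "1 \<le> a" "a \<le> b" "b \<le> 2"
      then have "a \<in> {1, 2}" "b \<in> {1, 2}"
        by auto
      then show "alpha_const (\<nu> a (fst (z l)) (snd (z l)) * \<nu> b (fst (z m)) (snd (z m))) * alpha a b =
          alpha_const s * (alpha_const (\<nu> a (fst (z' l)) (snd (z' l)) * \<nu> b (fst (z' m)) (snd (z' m))) * alpha a b)"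
        by (simp only: \<nu>[of a l] \<nu>[of b m] s_def alpha_const_mult ac_simps)
    qed
    then show ?thesis
      by (simp add: h s_def alpha_const_mult)
  qed
  have edge: "edge_weight \<omega> z e =
      (if fst e = i then k else 1) * (if snd e = i then k else 1) * edge_weight \<omega> z' e"
    if e: "e \<in> {1..n} \<times> {1..n}" "e \<noteq> (i, i)" for e
  proof -
    obtain l m where h: "e = (l, m)"
      by (cases e)
    \<comment> \<open>Distinctness of the points keeps every edge between \<open>i\<close> and
      another vertex off the diagonal.\<close>
    have other: "local_coord X \<A> (fst (z j)) \<and> snd (z j) \<in> fst (fst (z j)) \<and> p \<noteq> snd (z j)"
      if "j \<in> {1..n}" "j \<noteq> i" for j
      using insertions[OF that(1)] inj_onD[OF distinct_points, of i j] that i by (auto simp: zi)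
    consider "l = i" "m \<noteq> i" | "l \<noteq> i" "m = i" | "l \<noteq> i" "m \<noteq> i"
      using e h by auto
    then show ?thesis
    proof cases
      case 1
      then show ?thesis
        using other[of m] e bidifferential_new(1)[OF \<omega> p, of "fst (z m)" "snd (z m)"]
        by (simp add: h edge_weight_def zi z'i z'j k_def)
    next
      case 2
      then show ?thesis
        using other[of l] e bidifferential_new(2)[OF \<omega> p, of "fst (z l)" "snd (z l)"]
        by (simp add: h edge_weight_def zi z'i z'j k_def)
    next
      case 3
      then show ?thesis
        by (simp add: h edge_weight_def z'j)
    qed
  qed
  have loop: "edge_weight \<omega> z (i, i) = k\<^sup>2 * edge_weight \<omega> z' (i, i) + S / 6"
    by (simp add: edge_weight_def zi z'i k_def S_def proj_conn_new[OF \<omega> p] add_divide_distrib)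
  let ?G = "virasoro_graphs n" and ?G1 = "virasoro_graphs (n - 1)"
  let ?L = "{E \<in> ?G. (i, i) \<in> E}" and ?N = "{E \<in> ?G. (i, i) \<notin> E}"
  \<comment> \<open>Applied on both sides of the law, this separates the graphs that scale
    homogeneously from those that carry the additive term.\<close>
  have split: "(\<Sum>E\<in>?G. g E) = (\<Sum>E\<in>?N. g E) + (\<Sum>E\<in>?G1. g (add_loop i E))" for g :: "_ \<Rightarrow> complex"
  proof -
    have "(\<Sum>E\<in>?G. g E) = (\<Sum>E\<in>?N. g E) + (\<Sum>E\<in>?L. g E)"
      by (subst sum.union_disjoint[symmetric])
        (auto simp: finite_virasoro_graphs intro!: sum.cong)
    then show ?thesis
      by (simp add: virasoro_graphs_with_loop[OF i] sum.reindex inj_on_subset[OF inj_add_loop])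
  qed
  have N: "?op (?w E) = k\<^sup>2 * ?op (?w' E)" if E: "E \<in> ?N" for E
  proof -
    have "?w E = alpha_const (k\<^sup>2) * ?w' E"
      using E by (intro graph_weight_scale_vertex[of E n i] i edge chain) (auto simp: virasoro_graphs_iff)
    then show ?thesis
      using alpha_to_operator_linear[of \<tau> "k\<^sup>2" "?w' E" 0 0 F] by simp
  qed
  have L: "?op (?w (add_loop i E)) = k\<^sup>2 * ?op (?w' (add_loop i E)) + c / 12 * S * ?op (?w1 E)"
    if E: "E \<in> ?G1" for E
  proof -
    have fin: "finite E"
      using E by (rule finite_virasoro_graph)
    \<comment> \<open>The loop has the same cofactor in either coordinate, so only the scalar weight
      of the loop has to be compared.\<close>
    have "omit i z' = omit i z"
      by (simp add: z'_def)
    moreover have "c / 2 * edge_weight \<omega> z (i, i) =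
        k\<^sup>2 * (c / 2 * edge_weight \<omega> z' (i, i)) + c / 12 * S"
      by (simp add: loop algebra_simps)
    ultimately have "?w (add_loop i E) =
        alpha_const (k\<^sup>2) * ?w' (add_loop i E) + alpha_const (c / 12 * S) * ?w1 E"
      unfolding graph_weight_add_loop[OF fin i]
      by (simp only: alpha_const_add alpha_const_mult distrib_right mult.assoc)
    then show ?thesis
      by (simp only: alpha_to_operator_linear)
  qed
  \<comment> \<open>The \<open>k\<^sup>2\<close> terms with and without a loop recombine into the
    full sum for \<open>z'\<close>; what is left over runs over all graphs of order
    \<open>n - 1\<close>.\<close>
  have "(\<Sum>E\<in>?G. ?op (?w E)) = k\<^sup>2 * (\<Sum>E\<in>?G. ?op (?w' E)) + c / 12 * S * (\<Sum>E\<in>?G1. ?op (?w1 E))"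
    unfolding split by (simp add: N L sum.distrib sum_distrib_left algebra_simps)
  then show ?thesis
    by (simp add: virasoro_operator_def k_def S_def \<tau>_def z'_def)
qed

end
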